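(* Let $X=(X(t),t\in\mathbb{R})$ be a real-valued centered stationary Gaussian process with continuous sample paths, whose covariance function $R_X$ is positive and satisfies $R_X(t)=L(t)/|t|^\beta$ with $0<\beta<1$ and $L$ slowly varying at infinity. Let $\mathcal{W}_\beta$ be the (nonempty) set of Borel probability measures on $[0,1]$ minimizing $\int_0^1\int_0^1|u-v|^{-\beta}\mu(du)\mu(dv)$. Then for any $\mu_\beta\in\mathcal{W}_\beta$, $$\lim_{a\to\infty}R_X(a)\,C_X(a)=\Big(\int_0^1\!\!\int_0^1\frac{\mu_\beta(du)\,\mu_\beta(dv)}{|u-v|^\beta}\Big)^{-1}.$$
   Context: For $a>0$, $C_X(a)$ is defined by $\lim_{u\to\infty}u^{-2}\log P(X(t)>u,\ 0\le t\le a)=-\frac12C_X(a)$; equivalently $C_X(a)=\big[\min_{\mu}\int_0^1\int_0^1R_X(a(u-v))\mu(du)\mu(dv)\big]^{-1}$, the minimum over Borel probability measures $\mu$ on $[0,1]$. *)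

theory Defs
  imports "HOL-Probability.Probability"
begin

definition real_gaussian_rv :: "'a measure \<Rightarrow> ('a \<Rightarrow> real) \<Rightarrow> bool" where
  "real_gaussian_rv M Y \<longleftrightarrow> Y \<in> borel_measurable M \<and>
     ((\<exists>c. AE \<omega> in M. Y \<omega> = c) \<or>
      (\<exists>m \<sigma>. \<sigma> > 0 \<and> distributed M lborel Y (normal_density m \<sigma>)))"

definition gaussian_process :: "'a measure \<Rightarrow> (real \<Rightarrow> 'a \<Rightarrow> real) \<Rightarrow> bool" where
  "gaussian_process M X \<longleftrightarrow> prob_space M \<and>
     (\<forall>F c. finite F \<longrightarrow> real_gaussian_rv M (\<lambda>\<omega>. \<Sum>t\<in>F. c t * X t \<omega>))"

definition slowly_varying :: "(real \<Rightarrow> real) \<Rightarrow> bool" where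
  "slowly_varying L \<longleftrightarrow> (\<forall>\<^sub>F x in at_top. L x > 0) \<and>
     (\<forall>c>0. ((\<lambda>x. L (c * x) / L x) \<longlongrightarrow> 1) at_top)"

definition prob_measures_01 :: "real measure set" where
  "prob_measures_01 = {\<mu>. prob_space \<mu> \<and> sets \<mu> = sets borel \<and> emeasure \<mu> {0..1} = 1}"

text \<open>The constant C_X(a), via the min-formula characterization in terms of R_X.\<close>
definition CX :: "(real \<Rightarrow> real) \<Rightarrow> real \<Rightarrow> real" where
  "CX R a = 1 / Inf ((\<lambda>\<mu>. \<integral>u. (\<integral>v. R (a * (u - v)) \<partial>\<mu>) \<partial>\<mu>) ` prob_measures_01)"

definition riesz_energy :: "real \<Rightarrow> real measure \<Rightarrow> ennreal" where
  "riesz_energy \<beta> \<mu> = (\<integral>\<^sup>+u. (\<integral>\<^sup>+v. (if u = v then \<infinity> else ennreal (\<bar>u - v\<bar> powr (-\<beta>))) \<partial>\<mu>) \<partial>\<mu>)"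

definition riesz_minimizers :: "real \<Rightarrow> real measure set" where
  "riesz_minimizers \<beta> = {\<mu> \<in> prob_measures_01. \<forall>\<nu>\<in>prob_measures_01. riesz_energy \<beta> \<mu> \<le> riesz_energy \<beta> \<nu>}"

end

theory Submission
  imports Defs
begin

text \<open>
  For a probability measure \<open>\<mu>\<close> on \<open>[0,1]\<close> let \<open>smear h \<mu>\<close> be the law of \<open>(U + h S) / (1 + h)\<close>, where \<open>U\<close> has law
  \<open>\<mu>\<close> and \<open>S\<close> is independent and uniform on \<open>[0,1]\<close>. Smeared measures have bounded densities, so their
  energies for the kernel \<open>R (a x) / R a\<close> converge to their Riesz energies, uniformly in \<open>\<mu>\<close>, as soon as
  \<open>R (a x) / R a\<close> converges to \<open>|x| powr (-\<beta>)\<close> in \<open>L\<^sup>1[-1,1]\<close>; this follows from a Potter bound. For the upper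
  bound on the minimal energy one smears the Riesz minimizer, whose Riesz energy changes little when
  \<open>h\<close> is small. For the lower bound, positive definiteness of \<open>R\<close> shows that smearing an arbitrary \<open>\<mu>\<close>
  does not increase its \<open>R\<close>-energy (up to rescaling \<open>a\<close> by \<open>1 + h\<close>), while the smeared measure has Riesz
  energy at least the minimum; no weak compactness is needed.
\<close>

section \<open>Regular variation and L1 convergence of the rescaled covariance\<close>

lemma integrable_abs_powr:
  fixes \<gamma> :: real
  assumes "\<gamma> < 1"
  shows "integrable lborel (\<lambda>x::real. indicator {-1..1} x * \<bar>x\<bar> powr (-\<gamma>))"
proof -
  let ?f = "\<lambda>x::real. indicator {0..1} x * x powr (-\<gamma>)"
  have "((\<lambda>x. x powr (-\<gamma>)) has_integral (1 powr (-\<gamma>+1) / (-\<gamma>+1))) {0..1::real}"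
    by (rule has_integral_powr_from_0) (use assms in auto)
  from nn_integral_has_integral_lebesgue[OF _ this]
  have "(\<integral>\<^sup>+x. ennreal (?f x) \<partial>lborel) < \<infinity>" by simp
  then have f: "integrable lborel ?f"
    by (intro integrableI_nonneg) auto
  have g: "integrable lborel (\<lambda>x. ?f (- x))"
    using lborel_integrable_real_affine[OF f, of "-1" 0] by simp
  have "integrable lborel (\<lambda>x. ?f x + ?f (- x))"
    using f g by (rule Bochner_Integration.integrable_add)
  moreover have "(\<lambda>x. ?f x + ?f (- x)) = (\<lambda>x. indicator {-1..1} x * \<bar>x\<bar> powr (-\<gamma>))"
    by (auto simp: fun_eq_iff indicator_def)
  ultimately show ?thesis by simp
qed

text \<open>Regular variation of index -\<beta> is stated through ratios, so the slowly varying
  factor does not appear. \<open>R_le\<close> and \<open>R_even\<close> are the two traces of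
  positive definiteness used in the analytic part; they are proved below from the process.\<close>

locale regularly_varying =
  fixes R :: "real \<Rightarrow> real" and \<beta> :: real
  assumes R_meas [measurable]: "R \<in> borel_measurable borel"
    and R_pos: "\<And>t. R t > 0"
    and R_le: "\<And>t. R t \<le> R 0"
    and R_even: "\<And>t. R (- t) = R t"
    and beta: "0 < \<beta>" "\<beta> < 1"
    and ratio_tendsto: "\<And>c. c > 0 \<Longrightarrow> ((\<lambda>x. R (c * x) / R x) \<longlongrightarrow> c powr (-\<beta>)) at_top"
begin

text \<open>The ratios converge pointwise; truncating the defect at 1 supplies a dominating function
  before any bound on the ratios is known.\<close>

lemma truncated_L1_tendsto:
  "((\<lambda>x. \<integral>s. indicator {1..4} s * min 1 \<bar>R (s * x) / R x - s powr (-\<beta>)\<bar> \<partial>lborel) \<longlongrightarrow> 0) at_top"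
proof -
  have "((\<lambda>x. \<integral>s. indicator {1..4} s * min 1 \<bar>R (s * x) / R x - s powr (-\<beta>)\<bar> \<partial>lborel)
      \<longlongrightarrow> (\<integral>s. 0 \<partial>(lborel :: real measure))) at_top"
  proof (rule integral_dominated_convergence_at_top[where w = "indicator {1..4}"])
    show "AE s in lborel. ((\<lambda>x. indicator {1..4} s * min 1 \<bar>R (s * x) / R x - s powr (-\<beta>)\<bar>) \<longlongrightarrow> 0) at_top"
    proof (rule AE_I2)
      fix s :: real
      show "((\<lambda>x. indicator {1..4} s * min 1 \<bar>R (s * x) / R x - s powr (-\<beta>)\<bar>) \<longlongrightarrow> 0) at_top"
      proof (cases "s \<in> {1..4}")
        case True
        then have "((\<lambda>x. min 1 \<bar>R (s * x) / R x - s powr (-\<beta>)\<bar>) \<longlongrightarrow> min 1 \<bar>s powr (-\<beta>) - s powr (-\<beta>)\<bar>) at_top"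
          by (intro tendsto_intros ratio_tendsto) auto
        then show ?thesis using True by simp
      qed simp
    qed
  qed (auto simp: indicator_def)
  then show ?thesis by simp
qed

text \<open>A quantitative measure argument in place of the uniform convergence theorem. If
  \<open>R y\<close> exceeded \<open>16 * R (l * y)\<close>, then every \<open>R (s * y)\<close>
  with \<open>s\<close> in \<open>{2..4}\<close> would be either too small compared with
  \<open>R y\<close> or too large compared with \<open>R (l * y)\<close>. One of the two truncated
  defects would then be at least 1/8 at each \<open>s\<close>, against the smallness of their
  integrals.\<close>

lemma locally_bounded_ratio:
  "\<exists>A>0. \<forall>y\<ge>A. \<forall>l\<in>{1..2}. R y \<le> 16 * R (l * y)"
proof -
  define g where "g x s = indicator {1..4} s * min 1 \<bar>R (s * x) / R x - s powr (-\<beta>)\<bar>" for x s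
  have g_meas [measurable]: "g x \<in> borel_measurable borel" for x
    unfolding g_def by measurable
  have g_nonneg: "g x s \<ge> 0" for x s by (auto simp: g_def indicator_def)
  have g_int: "integrable lborel (g x)" for x
  proof (rule Bochner_Integration.integrable_bound)
    show "integrable lborel (indicator {1..4::real} :: real \<Rightarrow> real)" by simp
  qed (auto simp: g_def indicator_def)
  have "eventually (\<lambda>x. (\<integral>s. g x s \<partial>lborel) < 1/16) at_top"
    using order_tendstoD(2)[OF truncated_L1_tendsto, of "1/16"] by (simp add: g_def)
  then obtain A0 where A0: "\<And>x. x \<ge> A0 \<Longrightarrow> (\<integral>s. g x s \<partial>lborel) < 1/16"
    by (auto simp: eventually_at_top_linorder)
  have "R y \<le> 16 * R (l * y)" if y: "y \<ge> max A0 1" and l: "l \<in> {1..2}" for y l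
  proof (rule ccontr)
    assume neg: "\<not> R y \<le> 16 * R (l * y)"
    have ly: "l * y \<ge> y" using y l by (simp add: mult_le_cancel_right1)
    \<comment> \<open>\<open>s y = (s / l) (l y)\<close>: for each \<open>s\<close> one of the two ratios at \<open>s y\<close> is far from its limit.\<close>
    have pt: "indicator {2..4} s / 8 \<le> g y s + g (l * y) (0 + (1 / l) * s)" for s
    proof (cases "s \<in> {2..4}")
      case True
      have sl: "s / l \<in> {1..4}" using True l by (auto simp: field_simps)
      have "s / l * (l * y) = s * y" using l by auto
      then have gl: "g (l * y) (s / l) = min 1 \<bar>R (s * y) / R (l * y) - (s / l) powr (-\<beta>)\<bar>"
        using sl by (simp add: g_def)
      have gy: "g y s = min 1 \<bar>R (s * y) / R y - s powr (-\<beta>)\<bar>"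
        using True by (simp add: g_def)
      show ?thesis
      proof (cases "R (s * y) / R y < 1/8")
        case c: True
        have "4 powr (-1) \<le> s powr (-1)" using True by (intro powr_mono2') auto
        also have "\<dots> \<le> s powr (-\<beta>)" using True beta by (intro powr_mono) auto
        finally have "s powr (-\<beta>) \<ge> 1/4" by (simp add: powr_minus)
        then have "g y s \<ge> 1/8" unfolding gy using c by linarith
        then show ?thesis using g_nonneg[of "l * y" "0 + (1 / l) * s"] True by simp
      next
        case False
        then have a: "R (s * y) \<ge> R y / 8" using R_pos[of y] by (simp add: field_simps)
        then have "R (s * y) > 2 * R (l * y)" using neg by linarith
        then have b: "R (s * y) / R (l * y) > 2" using R_pos[of "l * y"] by (simp add: field_simps)
        have "(s / l) powr (-\<beta>) \<le> 1 powr (-\<beta>)" using sl beta by (intro powr_mono2') auto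
        then have "g (l * y) (s / l) \<ge> 1" unfolding gl using b by simp
        then show ?thesis using g_nonneg[of y s] True by simp
      qed
    next
      case False
      then show ?thesis using g_nonneg by (simp add: add_nonneg_nonneg)
    qed
    have i2: "integrable lborel (\<lambda>s. g (l * y) (0 + (1 / l) * s))"
      using l by (intro lborel_integrable_real_affine g_int) auto
    have e2: "(\<integral>s. g (l * y) (0 + (1 / l) * s) \<partial>lborel) = l * (\<integral>s. g (l * y) s \<partial>lborel)"
      using lborel_integral_real_affine[of "1 / l" "g (l * y)" 0] l by simp
    \<comment> \<open>The left side is 1/4. The right side is at most 3/16, the factor
      \<open>l \<le> 2\<close> being the Jacobian of \<open>s \<mapsto> s / l\<close>.\<close>
    have "(\<integral>s. indicator {2..4::real} s / 8 \<partial>lborel) \<le> (\<integral>s. g y s + g (l * y) (0 + (1 / l) * s) \<partial>lborel)"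
      by (intro integral_mono pt Bochner_Integration.integrable_add g_int i2) simp
    also have "\<dots> = (\<integral>s. g y s \<partial>lborel) + l * (\<integral>s. g (l * y) s \<partial>lborel)"
      by (subst Bochner_Integration.integral_add[OF g_int i2]) (simp only: e2)
    also have "\<dots> \<le> 1/16 + 2 * (1/16)"
      using less_imp_le[OF A0[of y]] less_imp_le[OF A0[of "l * y"]] order_trans[OF _ ly, of A0] y l
      by (intro add_mono mult_mono Bochner_Integration.integral_nonneg g_nonneg) auto
    finally show False by simp
  qed
  then show ?thesis by (intro exI[of _ "max A0 1"]) auto
qed

text \<open>Since the limit \<open>2 powr (-\<beta>)\<close> of the doubling ratio exceeds
  \<open>2 powr (-\<gamma>)\<close>, each doubling of a large argument costs at most a factor
  \<open>2 powr \<gamma>\<close>, exactly what \<open>(x / y) powr \<gamma>\<close> gains. Halving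
  \<open>x\<close> until it lies below \<open>2 * y\<close> leaves a case covered by the local
  bound, so the constant 16 is paid once.\<close>

lemma potter_bound:
  assumes "\<gamma> > \<beta>"
  shows "\<exists>A>0. \<forall>y\<ge>A. \<forall>x\<ge>y. R y \<le> 16 * (x / y) powr \<gamma> * R x"
proof -
  obtain A1 where A1: "A1 > 0" "\<And>y l. y \<ge> A1 \<Longrightarrow> l \<in> {1..2} \<Longrightarrow> R y \<le> 16 * R (l * y)"
    using locally_bounded_ratio by blast
  have "(2::real) powr (-\<gamma>) < 2 powr (-\<beta>)" using assms by simp
  then have "eventually (\<lambda>x. 2 powr (-\<gamma>) < R (2 * x) / R x) at_top"
    using order_tendstoD(1)[OF ratio_tendsto[of 2]] by simp
  then obtain A2 where A2: "\<And>x. x \<ge> A2 \<Longrightarrow> 2 powr (-\<gamma>) < R (2 * x) / R x"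
    by (auto simp: eventually_at_top_linorder)
  have dbl: "R x \<le> 2 powr \<gamma> * R (2 * x)" if "x \<ge> A2" for x
    using A2[OF that] R_pos[of x] by (simp add: field_simps powr_minus)
  define A where "A = max A1 A2"
  have A: "A > 0" using A1(1) by (simp add: A_def)
  have *: "R y \<le> 16 * (x / y) powr \<gamma> * R x" if "y \<ge> A" "y \<le> x" "x \<le> 2 ^ n * y" for x y n
    using that(2,3)
  proof (induction n arbitrary: x)
    case 0
    then have "x = y" by simp
    then show ?case using A that(1) R_pos[of y] by simp
  next
    case (Suc n)
    show ?case
    proof (cases "x \<le> 2 * y")
      case True
      then have "R y \<le> 16 * R ((x / y) * y)"
        using that(1) A Suc.prems by (intro A1(2)) (auto simp: A_def field_simps)
      also have "\<dots> = 16 * 1 * R x" using that(1) A by simp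
      also have "\<dots> \<le> 16 * (x / y) powr \<gamma> * R x"
        using that(1) A Suc.prems assms beta R_pos[of x]
        by (intro mult_right_mono mult_left_mono ge_one_powr_ge_zero) (auto simp: field_simps)
      finally show ?thesis .
    next
      case False
      have "R y \<le> 16 * (x / 2 / y) powr \<gamma> * R (x / 2)"
        using Suc.prems False by (intro Suc.IH) auto
      also have "\<dots> \<le> 16 * (x / 2 / y) powr \<gamma> * (2 powr \<gamma> * R (2 * (x / 2)))"
        using False that(1) by (intro mult_left_mono dbl) (auto simp: A_def)
      also have "\<dots> = 16 * (x / y) powr \<gamma> * R x"
        using False that(1) A by (simp add: powr_mult[symmetric] mult.assoc[symmetric])
      finally show ?thesis .
    qed
  qed
  have "R y \<le> 16 * (x / y) powr \<gamma> * R x" if "y \<ge> A" "y \<le> x" for x y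
  proof -
    obtain n where "x / y < 2 ^ n" using real_arch_pow[of 2 "x / y"] by auto
    then have "x \<le> 2 ^ n * y" using that A by (simp add: field_simps)
    then show ?thesis using * that by blast
  qed
  then show ?thesis using A by blast
qed

text \<open>While \<open>a * x\<close> stays above the threshold \<open>A\<close>, this is the
  Potter bound between \<open>a * x\<close> and \<open>a\<close>. Below it, \<open>R (a * x)\<close>
  is bounded by \<open>R 0\<close>, the Potter bound is applied between \<open>A\<close> and
  \<open>a\<close>, and \<open>a / A < inverse x\<close> turns the result into a power of
  \<open>x\<close>.\<close>

lemma ratio_dominated:
  assumes "\<gamma> > \<beta>"
  shows "\<exists>A>0. \<exists>C\<ge>0. \<forall>a\<ge>A. \<forall>x\<in>{0<..1}. R (a * x) / R a \<le> C * x powr (-\<gamma>)"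
proof -
  obtain A where A: "A > 0" "\<And>y x. y \<ge> A \<Longrightarrow> y \<le> x \<Longrightarrow> R y \<le> 16 * (x / y) powr \<gamma> * R x"
    using potter_bound[OF assms] by blast
  \<comment> \<open>The constant of the case \<open>a * x < A\<close>; it also covers the other case
    because \<open>R A \<le> R 0\<close>.\<close>
  define C where "C = 16 * R 0 / R A"
  have C: "C \<ge> 16" using R_le[of A] R_pos[of A] by (simp add: C_def field_simps)
  have "R (a * x) / R a \<le> C * x powr (-\<gamma>)" if a: "a \<ge> A" and x: "x \<in> {0<..1}" for a x
  proof (cases "a * x \<ge> A")
    case True
    have "R (a * x) \<le> 16 * (a / (a * x)) powr \<gamma> * R a"
      using True a A(1) x by (intro A(2)) (auto simp: mult_le_cancel_left1)
    also have "a / (a * x) = inverse x" using a A(1) by (simp add: field_simps)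
    also have "inverse x powr \<gamma> = x powr (-\<gamma>)" using x by (simp add: powr_minus inverse_powr)
    finally have "R (a * x) / R a \<le> 16 * x powr (-\<gamma>)" using R_pos[of a] by (simp add: field_simps)
    also have "\<dots> \<le> C * x powr (-\<gamma>)" using C by (intro mult_right_mono) auto
    finally show ?thesis .
  next
    case False
    have "R A \<le> 16 * (a / A) powr \<gamma> * R a" using A a by auto
    also have "\<dots> \<le> 16 * (inverse x) powr \<gamma> * R a"
      using False A(1) a x assms beta R_pos[of a]
      by (intro mult_right_mono mult_left_mono powr_mono2) (auto simp: field_simps)
    also have "inverse x powr \<gamma> = x powr (-\<gamma>)" using x by (simp add: powr_minus inverse_powr)
    finally have 1: "1 / R a \<le> 16 * x powr (-\<gamma>) / R A" using R_pos[of a] R_pos[of A] by (simp add: field_simps)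
    have "R (a * x) / R a = R (a * x) * (1 / R a)" by simp
    also have "\<dots> \<le> R 0 * (16 * x powr (-\<gamma>) / R A)"
      using 1 R_le R_pos[of 0] R_pos[of a] by (intro mult_mono) auto
    finally show ?thesis by (simp add: C_def mult_ac)
  qed
  then show ?thesis using A(1) C by (intro exI[of _ A] conjI exI[of _ C]) auto
qed

text \<open>The interval \<open>{-1..1}\<close> contains all differences of points of
  \<open>{0..1}\<close>. Values in \<open>ennreal\<close> allow the defect to be added to energies
  that may be infinite.\<close>

definition L1_defect :: "real \<Rightarrow> ennreal" where
  "L1_defect a = (\<integral>\<^sup>+x. ennreal (indicator {-1..1} x * \<bar>R (a * x) / R a - \<bar>x\<bar> powr (-\<beta>)\<bar>) \<partial>lborel)"

lemma L1_defect_tendsto: "(L1_defect \<longlongrightarrow> 0) at_top"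
proof -
  \<comment> \<open>Above \<beta> for the Potter domination, below 1 for integrability of the
    dominating function at 0.\<close>
  define \<gamma> where "\<gamma> = (\<beta> + 1) / 2"
  have \<gamma>: "\<beta> < \<gamma>" "\<gamma> < 1" using beta by (auto simp: \<gamma>_def)
  obtain A C where A: "A > 0" "C \<ge> 0"
    and dom: "\<And>a x. a \<ge> A \<Longrightarrow> x \<in> {0<..1} \<Longrightarrow> R (a * x) / R a \<le> C * x powr (-\<gamma>)"
    using ratio_dominated[OF \<gamma>(1)] by blast
  define f where "f a x = indicator {-1..1} x * \<bar>R (a * x) / R a - \<bar>x\<bar> powr (-\<beta>)\<bar>" for a x
  define w where "w x = C * (indicator {-1..1} x * \<bar>x\<bar> powr (-\<gamma>)) + indicator {-1..1} x * \<bar>x\<bar> powr (-\<beta>)" for x :: real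
  have w_int: "integrable lborel w"
    unfolding w_def using \<gamma> beta
    by (intro Bochner_Integration.integrable_add integrable_mult_right integrable_abs_powr)
  have f_meas [measurable]: "f a \<in> borel_measurable borel" for a unfolding f_def by measurable
  have R_abs: "R (a * x) = R (a * \<bar>x\<bar>)" for a x
    using R_even[of "a * x"] by (auto simp: abs_if)
  \<comment> \<open>The origin is set aside because \<open>0 powr (-\<beta>)\<close> has the default
    value 0, which is not the limit of \<open>R 0 / R a\<close>.\<close>
  have AE0: "AE x in lborel. x \<noteq> (0::real)" by (rule AE_lborel_singleton)
  have fw: "AE x in lborel. norm (f a x) \<le> w x" if "a \<ge> A" for a
    using AE0
  proof eventually_elim
    fix x :: real assume "x \<noteq> 0"
    show "norm (f a x) \<le> w x"
    proof (cases "x \<in> {-1..1}")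
      case True
      then have "R (a * \<bar>x\<bar>) / R a \<le> C * \<bar>x\<bar> powr (-\<gamma>)"
        using \<open>x \<noteq> 0\<close> that by (intro dom) auto
      moreover have "R (a * \<bar>x\<bar>) / R a \<ge> 0" using R_pos by (simp add: less_imp_le)
      ultimately have "\<bar>R (a * \<bar>x\<bar>) / R a - \<bar>x\<bar> powr (-\<beta>)\<bar> \<le> C * \<bar>x\<bar> powr (-\<gamma>) + \<bar>x\<bar> powr (-\<beta>)"
        using powr_ge_zero[of "\<bar>x\<bar>" "-\<beta>"] by linarith
      then show ?thesis using True unfolding f_def w_def R_abs[of a x] by simp
    qed (simp add: f_def w_def)
  qed
  have "((\<lambda>a. \<integral>x. f a x \<partial>lborel) \<longlongrightarrow> (\<integral>x. 0 \<partial>(lborel :: real measure))) at_top"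
  proof (rule integral_dominated_convergence_at_top[OF _ _ w_int])
    show "AE x in lborel. ((\<lambda>a. f a x) \<longlongrightarrow> 0) at_top"
      using AE0
    proof eventually_elim
      fix x :: real assume "x \<noteq> 0"
      then have "((\<lambda>a. R (\<bar>x\<bar> * a) / R a) \<longlongrightarrow> \<bar>x\<bar> powr (-\<beta>)) at_top"
        by (intro ratio_tendsto) auto
      then have "((\<lambda>a. indicator {-1..1} x * \<bar>R (\<bar>x\<bar> * a) / R a - \<bar>x\<bar> powr (-\<beta>)\<bar>)
          \<longlongrightarrow> indicator {-1..1} x * \<bar>\<bar>x\<bar> powr (-\<beta>) - \<bar>x\<bar> powr (-\<beta>)\<bar>) at_top"
        by (intro tendsto_intros)
      then show "((\<lambda>a. f a x) \<longlongrightarrow> 0) at_top"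
        unfolding f_def R_abs[of _ x] by (simp add: mult.commute)
    qed
    show "\<forall>\<^sub>F a in at_top. AE x in lborel. norm (f a x) \<le> w x"
      using eventually_ge_at_top[of A] by eventually_elim (rule fw)
  qed auto
  then have "((\<lambda>a. ennreal (\<integral>x. f a x \<partial>lborel)) \<longlongrightarrow> ennreal 0) at_top"
    by (intro tendsto_ennrealI) simp
  moreover have "eventually (\<lambda>a. ennreal (\<integral>x. f a x \<partial>lborel) = L1_defect a) at_top"
    using eventually_ge_at_top[of A]
  proof eventually_elim
    fix a assume "a \<ge> A"
    have nn: "f a x \<ge> 0" for x by (simp add: f_def)
    have "integrable lborel (f a)"
    proof (rule Bochner_Integration.integrable_bound[OF w_int])
      show "AE x in lborel. norm (f a x) \<le> norm (w x)"
        using fw[OF \<open>a \<ge> A\<close>] by eventually_elim auto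
    qed simp
    then show "ennreal (\<integral>x. f a x \<partial>lborel) = L1_defect a"
      using nn unfolding L1_defect_def f_def[symmetric] by (subst nn_integral_eq_integral) auto
  qed
  ultimately show ?thesis by (simp add: filterlim_cong)
qed

end

section \<open>Energies and smeared measures\<close>

lemma prob_measures_01D:
  assumes "\<mu> \<in> prob_measures_01"
  shows "prob_space \<mu>" "sets \<mu> = sets borel" "AE u in \<mu>. u \<in> {0..1}"
proof -
  interpret prob_space \<mu> using assms by (simp add: prob_measures_01_def)
  show "prob_space \<mu>" by (rule prob_space_axioms)
  show s: "sets \<mu> = sets borel" using assms by (simp add: prob_measures_01_def)
  have "prob {0..1} = 1" using assms by (simp add: prob_measures_01_def measure_def)
  then show "AE u in \<mu>. u \<in> {0..1}"
    by (subst (asm) prob_eq_1) (auto simp: s)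
qed

text \<open>Kernels with values in \<open>ennreal\<close> may be infinite on the diagonal, and
  Tonelli applies to them directly.\<close>

definition kernel_energy :: "(real \<Rightarrow> ennreal) \<Rightarrow> real measure \<Rightarrow> ennreal" where
  "kernel_energy k \<mu> = (\<integral>\<^sup>+u. (\<integral>\<^sup>+v. k (u - v) \<partial>\<mu>) \<partial>\<mu>)"

section \<open>Smearing a measure by a uniform variable\<close>

abbreviation unif01 :: "real measure" where
  "unif01 \<equiv> uniform_measure lborel {0..1}"

text \<open>Dividing by \<open>1 + h\<close> brings the sum, which ranges over
  \<open>[0, 1 + h]\<close>, back into the unit interval.\<close>

definition smear :: "real \<Rightarrow> real measure \<Rightarrow> real measure" where
  "smear h \<mu> = distr (\<mu> \<Otimes>\<^sub>M unif01) borel (\<lambda>(u, s). (u + h * s) / (1 + h))"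

lemma prob_space_unif01: "prob_space unif01"
  by (rule prob_space_uniform_measure) auto

lemma AE_unif01: "AE s in unif01. s \<in> {0..1}"
  by (intro AE_uniform_measureI) auto

lemma smear_point:
  fixes h :: real
  assumes h: "h > 0" and "u \<in> {0..1}" "s \<in> {0..1}"
  shows "(u + h * s) / (1 + h) \<in> {0..1}"
proof -
  have "h * s \<le> h" using assms by (simp add: mult_left_le)
  then have "u + h * s \<le> 1 + h" using assms by (intro add_mono) auto
  moreover have "0 \<le> u + h * s" using assms by auto
  ultimately show ?thesis using h by simp
qed

lemma smear_prob_measure:
  assumes \<mu>: "\<mu> \<in> prob_measures_01" and h: "h > 0"
  shows "smear h \<mu> \<in> prob_measures_01"
proof -
  note [measurable_cong] = prob_measures_01D(2)[OF \<mu>]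
  interpret U: prob_space unif01 by (rule prob_space_unif01)
  interpret m: prob_space \<mu> by (rule prob_measures_01D(1)[OF \<mu>])
  interpret P: pair_prob_space \<mu> unif01 ..
  have meas: "(\<lambda>(u, s). (u + h * s) / (1 + h)) \<in> borel_measurable (\<mu> \<Otimes>\<^sub>M unif01)"
    by measurable
  have S: "prob_space (smear h \<mu>)" unfolding smear_def by (rule P.prob_space_distr[OF meas])
  interpret S: prob_space "smear h \<mu>" by (rule S)
  have "AE p in \<mu> \<Otimes>\<^sub>M unif01. fst p \<in> {0..1}"
  proof (rule P.AE_pair_measure)
    show "AE u in \<mu>. AE s in unif01. fst (u, s) \<in> {0..1}"
      using prob_measures_01D(3)[OF \<mu>] by eventually_elim simp
  qed measurable
  moreover have "AE p in \<mu> \<Otimes>\<^sub>M unif01. snd p \<in> {0..1}"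
  proof (rule P.AE_pair_measure)
    show "AE u in \<mu>. AE s in unif01. snd (u, s) \<in> {0..1}"
      using AE_unif01 by simp
  qed measurable
  ultimately have "AE p in \<mu> \<Otimes>\<^sub>M unif01. (case p of (u, s) \<Rightarrow> (u + h * s) / (1 + h)) \<in> {0..1}"
    by eventually_elim (use smear_point[OF h] in \<open>auto simp: split_beta\<close>)
  then have "AE x in smear h \<mu>. x \<in> {0..1}"
    unfolding smear_def by (subst AE_distr_iff[OF meas]) auto
  then have "S.prob {0..1} = 1"
    by (subst S.prob_eq_1) (auto simp: smear_def)
  then show ?thesis
    unfolding prob_measures_01_def using S by (simp add: S.emeasure_eq_measure) (simp add: smear_def)
qed

lemma kernel_energy_pair:
  assumes \<mu>: "\<mu> \<in> prob_measures_01" and [measurable]: "k \<in> borel_measurable borel"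
  shows "kernel_energy k \<mu> = (\<integral>\<^sup>+q. k (fst q - snd q) \<partial>(\<mu> \<Otimes>\<^sub>M \<mu>))"
proof -
  note [measurable_cong] = prob_measures_01D(2)[OF \<mu>]
  interpret m: prob_space \<mu> by (rule prob_measures_01D(1)[OF \<mu>])
  show ?thesis unfolding kernel_energy_def
    by (subst m.nn_integral_fst[symmetric]) auto
qed

text \<open>Two orders of integration for two uses. With
  \<open>\<mu> \<Otimes>\<^sub>M \<mu>\<close> inside, the energy is an average of shifted energies
  of \<open>\<mu>\<close>, suited to positive definiteness. With the uniform variables inside, it is
  the energy of \<open>\<mu>\<close> for a smoothed kernel, suited to the limit
  \<open>h \<rightarrow> 0\<close>.\<close>

lemma kernel_energy_smear:
  assumes \<mu>: "\<mu> \<in> prob_measures_01" and k [measurable]: "k \<in> borel_measurable borel"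
  shows "kernel_energy k (smear h \<mu>) =
      (\<integral>\<^sup>+p. (\<integral>\<^sup>+q. k ((fst q - snd q + h * (fst p - snd p)) / (1 + h)) \<partial>(\<mu> \<Otimes>\<^sub>M \<mu>)) \<partial>(unif01 \<Otimes>\<^sub>M unif01))"
    (is "_ = ?A")
    and "kernel_energy k (smear h \<mu>) =
      (\<integral>\<^sup>+q. (\<integral>\<^sup>+p. k ((fst q - snd q + h * (fst p - snd p)) / (1 + h)) \<partial>(unif01 \<Otimes>\<^sub>M unif01)) \<partial>(\<mu> \<Otimes>\<^sub>M \<mu>))"
    (is "_ = ?B")
proof -
  note [measurable_cong] = prob_measures_01D(2)[OF \<mu>]
  interpret U: prob_space unif01 by (rule prob_space_unif01)
  interpret m: prob_space \<mu> by (rule prob_measures_01D(1)[OF \<mu>])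
  interpret P: pair_prob_space \<mu> unif01 ..
  interpret UU: pair_prob_space unif01 unif01 ..
  interpret mm: pair_prob_space \<mu> \<mu> ..
  interpret UUmm: pair_prob_space "unif01 \<Otimes>\<^sub>M unif01" "\<mu> \<Otimes>\<^sub>M \<mu>" ..
  have D: "(\<integral>\<^sup>+y. f y \<partial>smear h \<mu>) = (\<integral>\<^sup>+s. (\<integral>\<^sup>+u. f ((u + h * s) / (1 + h)) \<partial>\<mu>) \<partial>unif01)"
    if [measurable]: "f \<in> borel_measurable borel" for f :: "real \<Rightarrow> ennreal"
    unfolding smear_def by (subst nn_integral_distr) (auto simp: P.nn_integral_snd[symmetric])
  have sf: "sigma_finite_measure (smear h \<mu>)"
    unfolding smear_def by (intro prob_space_imp_sigma_finite P.prob_space_distr) measurable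
  interpret S: sigma_finite_measure "smear h \<mu>" by (rule sf)
  have [measurable_cong]: "sets (smear h \<mu>) = sets borel" by (simp add: smear_def)
  have "kernel_energy k (smear h \<mu>) =
      (\<integral>\<^sup>+s. (\<integral>\<^sup>+u. (\<integral>\<^sup>+t. (\<integral>\<^sup>+v. k ((u + h * s) / (1 + h) - (v + h * t) / (1 + h)) \<partial>\<mu>) \<partial>unif01) \<partial>\<mu>) \<partial>unif01)"
    unfolding kernel_energy_def by (subst D) (auto simp: D)
  also have "\<dots> = (\<integral>\<^sup>+s. (\<integral>\<^sup>+t. (\<integral>\<^sup>+u. (\<integral>\<^sup>+v. k ((u + h * s) / (1 + h) - (v + h * t) / (1 + h)) \<partial>\<mu>) \<partial>\<mu>) \<partial>unif01) \<partial>unif01)"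
    by (intro nn_integral_cong P.Fubini'[symmetric]) measurable
  also have "\<dots> = (\<integral>\<^sup>+s. (\<integral>\<^sup>+t. (\<integral>\<^sup>+q. k ((fst q - snd q + h * (s - t)) / (1 + h)) \<partial>(\<mu> \<Otimes>\<^sub>M \<mu>)) \<partial>unif01) \<partial>unif01)"
    by (subst m.nn_integral_fst[symmetric]) (auto simp: diff_divide_distrib[symmetric] algebra_simps)
  also have "\<dots> = ?A"
    by (subst U.nn_integral_fst[symmetric]) auto
  finally show A: "kernel_energy k (smear h \<mu>) = ?A" .
  show "kernel_energy k (smear h \<mu>) = ?B"
    unfolding A by (intro UUmm.Fubini'[symmetric]) measurable
qed

text \<open>Smeared measures have a density bounded by \<open>(1 + h) / h\<close>.\<close>

lemma kernel_energy_smear_le: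
  assumes \<mu>: "\<mu> \<in> prob_measures_01" and g [measurable]: "g \<in> borel_measurable borel" and h: "h > 0"
  shows "kernel_energy g (smear h \<mu>) \<le> ennreal ((1 + h) / h) * (\<integral>\<^sup>+x. indicator {-1..1} x * g x \<partial>lborel)"
    (is "_ \<le> ?C * ?I")
proof -
  note [measurable_cong] = prob_measures_01D(2)[OF \<mu>]
  interpret U: prob_space unif01 by (rule prob_space_unif01)
  interpret m: prob_space \<mu> by (rule prob_measures_01D(1)[OF \<mu>])
  interpret P: pair_prob_space \<mu> unif01 ..
  have S: "smear h \<mu> \<in> prob_measures_01" by (rule smear_prob_measure[OF \<mu> h])
  interpret S: prob_space "smear h \<mu>" by (rule prob_measures_01D(1)[OF S])
  note [measurable_cong] = prob_measures_01D(2)[OF S]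
  \<comment> \<open>Substitute \<open>x = w - (u + h * s) / (1 + h)\<close>: the Jacobian is
    \<open>h / (1 + h)\<close>, and \<open>x\<close> stays in \<open>{-1..1}\<close> as a difference
    of two points of the unit interval.\<close>
  have inner: "(\<integral>\<^sup>+s. g (w - (u + h * s) / (1 + h)) \<partial>unif01) \<le> ?C * ?I"
    if u: "u \<in> {0..1}" and w: "w \<in> {0..1}" for u w
  proof -
    have "(\<integral>\<^sup>+s. g (w - (u + h * s) / (1 + h)) \<partial>unif01) =
        (\<integral>\<^sup>+s. g (w - (u + h * s) / (1 + h)) * indicator {0..1} s \<partial>lborel)"
      by (subst nn_integral_uniform_measure) (auto simp: divide_ennreal_def)
    also have "\<dots> \<le> (\<integral>\<^sup>+s. indicator {-1..1} ((w - u / (1 + h)) + (- (h / (1 + h))) * s)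
        * g ((w - u / (1 + h)) + (- (h / (1 + h))) * s) \<partial>lborel)"
    proof (intro nn_integral_mono)
      fix s :: real
      have eq: "w - (u + h * s) / (1 + h) = (w - u / (1 + h)) + (- (h / (1 + h))) * s"
        by (simp add: add_divide_distrib)
      have "w - (u + h * s) / (1 + h) \<in> {-1..1}" if s: "s \<in> {0..1}"
        using smear_point[OF h u s] w by auto
      then show "g (w - (u + h * s) / (1 + h)) * indicator {0..1} s \<le>
          indicator {-1..1} ((w - u / (1 + h)) + (- (h / (1 + h))) * s)
        * g ((w - u / (1 + h)) + (- (h / (1 + h))) * s)"
        unfolding eq by (auto simp: indicator_def)
    qed
    also have "\<dots> = ?C * (ennreal \<bar>- (h / (1 + h))\<bar> * \<dots>)"
      using h by (simp add: mult.assoc[symmetric] ennreal_mult[symmetric])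
    also have "\<dots> = ?C * ?I"
      using h by (subst nn_integral_real_affine[of "\<lambda>x. indicator {-1..1} x * g x" "- (h / (1 + h))" "w - u / (1 + h)"]) auto
    finally show ?thesis .
  qed
  have "kernel_energy g (smear h \<mu>) \<le> (\<integral>\<^sup>+w. ?C * ?I \<partial>smear h \<mu>)"
    unfolding kernel_energy_def
  proof (intro nn_integral_mono_AE)
    show "AE w in smear h \<mu>. (\<integral>\<^sup>+v. g (w - v) \<partial>smear h \<mu>) \<le> ?C * ?I"
      using prob_measures_01D(3)[OF S]
    proof eventually_elim
      fix w :: real assume w: "w \<in> {0..1}"
      have "(\<integral>\<^sup>+v. g (w - v) \<partial>smear h \<mu>) = (\<integral>\<^sup>+u. (\<integral>\<^sup>+s. g (w - (u + h * s) / (1 + h)) \<partial>unif01) \<partial>\<mu>)"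
        unfolding smear_def by (subst nn_integral_distr) (auto simp: U.nn_integral_fst[symmetric])
      also have "\<dots> \<le> (\<integral>\<^sup>+u. ?C * ?I \<partial>\<mu>)"
      proof (intro nn_integral_mono_AE)
        show "AE u in \<mu>. (\<integral>\<^sup>+s. g (w - (u + h * s) / (1 + h)) \<partial>unif01) \<le> ?C * ?I"
          using prob_measures_01D(3)[OF \<mu>] by eventually_elim (rule inner[OF _ w])
      qed
      also have "\<dots> = ?C * ?I" by (simp add: m.emeasure_space_1)
      finally show "(\<integral>\<^sup>+v. g (w - v) \<partial>smear h \<mu>) \<le> ?C * ?I" .
    qed
  qed
  also have "\<dots> = ?C * ?I" by (simp add: S.emeasure_space_1)
  finally show ?thesis .
qed

lemma kernel_energy_add:
  assumes \<mu>: "\<mu> \<in> prob_measures_01"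
    and [measurable]: "f \<in> borel_measurable borel" "g \<in> borel_measurable borel"
  shows "kernel_energy (\<lambda>x. f x + g x) \<mu> = kernel_energy f \<mu> + kernel_energy g \<mu>"
proof -
  note [measurable_cong] = prob_measures_01D(2)[OF \<mu>]
  show ?thesis
    by (simp add: kernel_energy_pair[OF \<mu>] nn_integral_add)
qed

lemma kernel_energy_mono: "(\<And>x. f x \<le> g x) \<Longrightarrow> kernel_energy f \<mu> \<le> kernel_energy g \<mu>"
  unfolding kernel_energy_def by (intro nn_integral_mono) auto

section \<open>Covariances of measurable stationary processes\<close>

text \<open>Joint measurability is what Fubini over time and probability requires. Paths in a
  measurable null set \<open>N\<close> containing the discontinuous ones are replaced by 0. Sampling
  at the grid points \<open>\<lfloor>(n + 1) * t\<rfloor> / (n + 1)\<close> gives countably many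
  measurable pieces, hence jointly measurable functions, which converge to the modified process by
  continuity of the remaining paths.\<close>

lemma jointly_measurable_modification:
  fixes X :: "real \<Rightarrow> 'a \<Rightarrow> real"
  assumes X [measurable]: "\<And>t. X t \<in> borel_measurable M"
    and cont: "AE \<omega> in M. continuous_on UNIV (\<lambda>t. X t \<omega>)"
  shows "\<exists>Y. case_prod Y \<in> borel_measurable (borel \<Otimes>\<^sub>M M) \<and> (\<forall>t. AE \<omega> in M. Y t \<omega> = X t \<omega>)"
proof -
  obtain N where N: "{\<omega> \<in> space M. \<not> continuous_on UNIV (\<lambda>t. X t \<omega>)} \<subseteq> N" "emeasure M N = 0" "N \<in> sets M"
    using cont by (rule AE_E)
  note [measurable] = N(3)
  define Y where "Y t \<omega> = (if \<omega> \<in> N then 0 else X t \<omega>)" for t \<omega>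
  have Yt [measurable]: "Y t \<in> borel_measurable M" for t
    unfolding Y_def by measurable
  define Z where "Z n p = Y (real_of_int \<lfloor>real (Suc n) * fst p\<rfloor> / real (Suc n)) (snd p)" for n and p :: "real \<times> 'a"
  have "case_prod Y \<in> borel_measurable (borel \<Otimes>\<^sub>M M)"
  proof (rule borel_measurable_LIMSEQ_real[where u = Z])
    show "Z n \<in> borel_measurable (borel \<Otimes>\<^sub>M M)" for n
      unfolding Z_def
      by (rule measurable_compose_countable[where f = "\<lambda>(i::int) p. Y (real_of_int i / real (Suc n)) (snd p)"
            and g = "\<lambda>p. \<lfloor>real (Suc n) * fst p\<rfloor>"]) measurable
    fix p assume p: "p \<in> space ((borel :: real measure) \<Otimes>\<^sub>M M)"
    obtain t \<omega> where tw: "p = (t, \<omega>)" by force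
    have w: "\<omega> \<in> space M" using p by (simp add: tw space_pair_measure)
    show "(\<lambda>n. Z n p) \<longlonglongrightarrow> case_prod Y p"
    proof (cases "\<omega> \<in> N")
      case False
      then have "continuous_on UNIV (\<lambda>t. X t \<omega>)" using N(1) w by blast
      then have c: "isCont (\<lambda>t. X t \<omega>) t" by (simp add: continuous_on_eq_continuous_at)
      have "(\<lambda>n. real_of_int \<lfloor>real (Suc n) * t\<rfloor> / real (Suc n)) \<longlonglongrightarrow> t"
      proof (rule tendsto_sandwich)
        show "(\<lambda>n. t - inverse (real (Suc n))) \<longlonglongrightarrow> t"
          using tendsto_diff[OF tendsto_const LIMSEQ_inverse_real_of_nat, of t] by simp
        show "\<forall>\<^sub>F n in sequentially. t - inverse (real (Suc n)) \<le> real_of_int \<lfloor>real (Suc n) * t\<rfloor> / real (Suc n)"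
        proof (rule always_eventually, rule allI)
          fix n
          have "real (Suc n) * t - 1 \<le> real_of_int \<lfloor>real (Suc n) * t\<rfloor>" by linarith
          then have "(real (Suc n) * t - 1) / real (Suc n) \<le> real_of_int \<lfloor>real (Suc n) * t\<rfloor> / real (Suc n)"
            by (rule divide_right_mono) simp
          moreover have "(real (Suc n) * t - 1) / real (Suc n) = t - inverse (real (Suc n))"
            by (simp add: diff_divide_distrib inverse_eq_divide del: of_nat_Suc)
          ultimately show "t - inverse (real (Suc n)) \<le> real_of_int \<lfloor>real (Suc n) * t\<rfloor> / real (Suc n)" by simp
        qed
        show "\<forall>\<^sub>F n in sequentially. real_of_int \<lfloor>real (Suc n) * t\<rfloor> / real (Suc n) \<le> t"
        proof (rule always_eventually, rule allI)
          fix n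
          have "real_of_int \<lfloor>real (Suc n) * t\<rfloor> \<le> real (Suc n) * t" by linarith
          then show "real_of_int \<lfloor>real (Suc n) * t\<rfloor> / real (Suc n) \<le> t"
            by (simp add: divide_le_eq mult.commute del: of_nat_Suc)
        qed
      qed simp
      then have "(\<lambda>n. X (real_of_int \<lfloor>real (Suc n) * t\<rfloor> / real (Suc n)) \<omega>) \<longlonglongrightarrow> X t \<omega>"
        by (rule isCont_tendsto_compose[OF c])
      then show ?thesis using False by (simp add: Z_def Y_def tw)
    qed (simp add: Z_def Y_def tw)
  qed
  moreover have "AE \<omega> in M. Y t \<omega> = X t \<omega>" for t
    using AE_not_in[of N M] N by (auto simp: Y_def null_sets_def)
  ultimately show ?thesis by blast
qed

text \<open>By Fubini the integral is the square of the integral of \<open>f\<close>; if the product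
  is not integrable, the Bochner integral has the default value 0. Both cases can thus be handled
  path by path.\<close>

lemma (in sigma_finite_measure) integral_tensor_square_nonneg:
  fixes f :: "'a \<Rightarrow> real"
  shows "0 \<le> (\<integral>q. f (fst q) * f (snd q) \<partial>(M \<Otimes>\<^sub>M M))"
proof (cases "integrable (M \<Otimes>\<^sub>M M) (\<lambda>q. f (fst q) * f (snd q))")
  case True
  interpret pair_sigma_finite M M ..
  have "(\<integral>q. f (fst q) * f (snd q) \<partial>(M \<Otimes>\<^sub>M M)) = (\<integral>u. (\<integral>v. f u * f v \<partial>M) \<partial>M)"
    using integral_fst'[OF True] by simp
  also have "\<dots> = (\<integral>u. f u \<partial>M) * (\<integral>v. f v \<partial>M)" by simp
  finally show ?thesis by simp
qed (simp add: not_integrable_integral_eq)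

section \<open>Second-moment inequalities for the covariance\<close>

locale measurable_stationary = prob_space M for M :: "'a measure" +
  fixes Y :: "real \<Rightarrow> 'a \<Rightarrow> real" and R :: "real \<Rightarrow> real"
  assumes joint_meas: "case_prod Y \<in> borel_measurable (borel \<Otimes>\<^sub>M M)"
    and cov: "\<And>s t. R t = (\<integral>\<omega>. Y (s + t) \<omega> * Y s \<omega> \<partial>M)"
    and cov_pos: "\<And>t. R t > 0"
begin

lemma Y_compose [measurable]:
  assumes [measurable]: "f \<in> borel_measurable N" "g \<in> measurable N M"
  shows "(\<lambda>x. Y (f x) (g x)) \<in> borel_measurable N"
proof -
  have "(\<lambda>x. case_prod Y (f x, g x)) \<in> borel_measurable N"
    by (rule measurable_compose[OF _ joint_meas]) measurable
  then show ?thesis by simp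
qed

lemma cov_eq: "(\<integral>\<omega>. Y s \<omega> * Y t \<omega> \<partial>M) = R (s - t)"
  using cov[of "s - t" t] by simp

lemma cov_even: "R (- t) = R t"
  using cov_eq[of 0 t] cov_eq[of t 0] by (simp add: mult.commute)

text \<open>A non-integrable square would have Bochner integral 0 by default, contradicting
  \<open>R 0 > 0\<close>. Finite second moments thus follow from positivity of the
  covariance.\<close>

lemma integrable_square: "integrable M (\<lambda>\<omega>. (Y t \<omega>)\<^sup>2)"
proof (rule ccontr)
  assume "\<not> ?thesis"
  then have "(\<integral>\<omega>. Y t \<omega> * Y t \<omega> \<partial>M) = 0"
    by (simp add: not_integrable_integral_eq power2_eq_square)
  then show False using cov_eq[of t t] cov_pos[of 0] by simp
qed

lemma integral_square: "(\<integral>\<omega>. (Y t \<omega>)\<^sup>2 \<partial>M) = R 0"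
  using cov_eq[of t t] by (simp add: power2_eq_square)

lemma integrable_prod: "integrable M (\<lambda>\<omega>. Y s \<omega> * Y t \<omega>)"
proof (rule Bochner_Integration.integrable_bound)
  show "integrable M (\<lambda>\<omega>. (Y s \<omega>)\<^sup>2 + (Y t \<omega>)\<^sup>2)"
    by (intro Bochner_Integration.integrable_add integrable_square)
  have "\<bar>x * y\<bar> \<le> x\<^sup>2 + y\<^sup>2" for x y :: real
  proof -
    have "2 * \<bar>x * y\<bar> \<le> x\<^sup>2 + y\<^sup>2"
      using sum_squares_bound[of "\<bar>x\<bar>" "\<bar>y\<bar>"] by (simp add: abs_mult)
    then show ?thesis using abs_ge_zero[of "x * y"] by (simp del: abs_ge_zero)
  qed
  then show "AE \<omega> in M. norm (Y s \<omega> * Y t \<omega>) \<le> norm ((Y s \<omega>)\<^sup>2 + (Y t \<omega>)\<^sup>2)"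
    by simp
qed measurable

lemma cov_le: "R t \<le> R 0"
proof -
  have "R t = (\<integral>\<omega>. Y t \<omega> * Y 0 \<omega> \<partial>M)" using cov_eq[of t 0] by simp
  also have "\<dots> \<le> (\<integral>\<omega>. ((Y t \<omega>)\<^sup>2 + (Y 0 \<omega>)\<^sup>2) / 2 \<partial>M)"
  proof (intro integral_mono integrable_prod)
    fix \<omega>
    show "Y t \<omega> * Y 0 \<omega> \<le> ((Y t \<omega>)\<^sup>2 + (Y 0 \<omega>)\<^sup>2) / 2"
      using sum_squares_bound[of "Y t \<omega>" "Y 0 \<omega>"] by simp
  qed (auto intro!: integrable_square)
  also have "\<dots> = R 0"
    by (simp add: integrable_square integral_square)
  finally show ?thesis .
qed

lemma cov_measurable [measurable]: "R \<in> borel_measurable borel"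
proof -
  have "(\<lambda>t. \<integral>\<omega>. Y t \<omega> * Y 0 \<omega> \<partial>M) \<in> borel_measurable borel"
    by measurable
  then show ?thesis using cov_eq[of _ 0] by simp
qed

text \<open>The increment process \<open>Y (a u + \<tau>) - Y (a u)\<close>, averaged over \<open>\<mu>\<close>, has nonnegative second moment.\<close>

lemma cov_shift_le:
  assumes \<mu>: "\<mu> \<in> prob_measures_01"
  shows "(\<integral>\<^sup>+q. ennreal (R (a * (fst q - snd q) + \<tau>)) \<partial>(\<mu> \<Otimes>\<^sub>M \<mu>)) \<le>
    (\<integral>\<^sup>+q. ennreal (R (a * (fst q - snd q))) \<partial>(\<mu> \<Otimes>\<^sub>M \<mu>))"
proof -
  note [measurable_cong] = prob_measures_01D(2)[OF \<mu>]
  interpret m: prob_space \<mu> by (rule prob_measures_01D(1)[OF \<mu>])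
  interpret mm: pair_prob_space \<mu> \<mu> ..
  interpret PM: pair_prob_space "\<mu> \<Otimes>\<^sub>M \<mu>" M ..
  define D where "D u \<omega> = Y (a * u + \<tau>) \<omega> - Y (a * u) \<omega>" for u \<omega>
  define k where "k \<sigma> q = R (a * (fst q - snd q) + \<sigma>)" for \<sigma> and q :: "real \<times> real"
  have k_meas [measurable]: "k \<sigma> \<in> borel_measurable (\<mu> \<Otimes>\<^sub>M \<mu>)" for \<sigma>
    unfolding k_def by measurable
  have k_int: "integrable (\<mu> \<Otimes>\<^sub>M \<mu>) (k \<sigma>)" for \<sigma>
    by (rule mm.integrable_const_bound[where B = "R 0"]) (use cov_le cov_pos in \<open>auto simp: k_def abs_of_pos\<close>)
  have DD: "D u \<omega> * D v \<omega> = Y (a * u + \<tau>) \<omega> * Y (a * v + \<tau>) \<omega> - Y (a * u + \<tau>) \<omega> * Y (a * v) \<omega>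
      - Y (a * u) \<omega> * Y (a * v + \<tau>) \<omega> + Y (a * u) \<omega> * Y (a * v) \<omega>" for u v \<omega>
    by (simp add: D_def algebra_simps)
  have D_int: "integrable M (\<lambda>\<omega>. D u \<omega> * D v \<omega>)" for u v
    unfolding DD by (intro Bochner_Integration.integrable_add Bochner_Integration.integrable_diff integrable_prod)
  have D_cov: "(\<integral>\<omega>. D (fst q) \<omega> * D (snd q) \<omega> \<partial>M) = 2 * k 0 q - k \<tau> q - k (- \<tau>) q" for q
    unfolding DD k_def by (simp add: integrable_prod cov_eq) (simp add: algebra_simps)
  have G_int: "integrable ((\<mu> \<Otimes>\<^sub>M \<mu>) \<Otimes>\<^sub>M M) (\<lambda>(q, \<omega>). D (fst q) \<omega> * D (snd q) \<omega>)"
  proof (rule PM.Fubini_integrable)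
    show meas: "(\<lambda>(q, \<omega>). D (fst q) \<omega> * D (snd q) \<omega>) \<in> borel_measurable ((\<mu> \<Otimes>\<^sub>M \<mu>) \<Otimes>\<^sub>M M)"
      unfolding D_def by measurable
    show "AE q in \<mu> \<Otimes>\<^sub>M \<mu>. integrable M (\<lambda>\<omega>. case (q, \<omega>) of (q, \<omega>) \<Rightarrow> D (fst q) \<omega> * D (snd q) \<omega>)"
      using D_int by simp
    show "integrable (\<mu> \<Otimes>\<^sub>M \<mu>) (\<lambda>q. \<integral>\<omega>. norm (case (q, \<omega>) of (q, \<omega>) \<Rightarrow> D (fst q) \<omega> * D (snd q) \<omega>) \<partial>M)"
    proof (rule mm.integrable_const_bound[where B = "4 * R 0"])
      show "(\<lambda>q. \<integral>\<omega>. norm (case (q, \<omega>) of (q, \<omega>) \<Rightarrow> D (fst q) \<omega> * D (snd q) \<omega>) \<partial>M) \<in> borel_measurable (\<mu> \<Otimes>\<^sub>M \<mu>)"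
        unfolding D_def by measurable
      have b: "\<bar>(x - y) * (z - w)\<bar> \<le> x\<^sup>2 + y\<^sup>2 + z\<^sup>2 + w\<^sup>2" for x y z w :: real
      proof -
        have 1: "2 * \<bar>(x - y) * (z - w)\<bar> \<le> (x - y)\<^sup>2 + (z - w)\<^sup>2"
          using sum_squares_bound[of "\<bar>x - y\<bar>" "\<bar>z - w\<bar>"] by (simp add: abs_mult)
        have 2: "(x - y)\<^sup>2 \<le> 2 * (x\<^sup>2 + y\<^sup>2)" and 3: "(z - w)\<^sup>2 \<le> 2 * (z\<^sup>2 + w\<^sup>2)"
          using zero_le_power2[of "x + y"] zero_le_power2[of "z + w"]
          by (auto simp: power2_eq_square algebra_simps)
        show ?thesis using order_trans[OF 1 add_mono[OF 2 3]] by simp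
      qed
      have "(\<integral>\<omega>. \<bar>D u \<omega> * D v \<omega>\<bar> \<partial>M) \<le> 4 * R 0" for u v
      proof -
        have "(\<integral>\<omega>. \<bar>D u \<omega> * D v \<omega>\<bar> \<partial>M) \<le> (\<integral>\<omega>. (Y (a * u + \<tau>) \<omega>)\<^sup>2 + (Y (a * u) \<omega>)\<^sup>2
            + (Y (a * v + \<tau>) \<omega>)\<^sup>2 + (Y (a * v) \<omega>)\<^sup>2 \<partial>M)"
          using D_int[of u v] by (intro integral_mono Bochner_Integration.integrable_add integrable_square integrable_abs)
            (auto simp: D_def b)
        then show ?thesis by (simp add: integrable_square integral_square)
      qed
      then show "AE q in \<mu> \<Otimes>\<^sub>M \<mu>. norm (\<integral>\<omega>. norm (case (q, \<omega>) of (q, \<omega>) \<Rightarrow> D (fst q) \<omega> * D (snd q) \<omega>) \<partial>M) \<le> 4 * R 0"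
        by (simp add: Bochner_Integration.integral_nonneg)
    qed
  qed
  \<comment> \<open>For fixed \<open>\<omega>\<close> the inner integral is a tensor square in the
    increments \<open>D\<close>; exchanging it with the expectation brings in the covariances
    \<open>D_cov\<close>.\<close>
  have "0 \<le> (\<integral>\<omega>. (\<integral>q. D (fst q) \<omega> * D (snd q) \<omega> \<partial>(\<mu> \<Otimes>\<^sub>M \<mu>)) \<partial>M)"
    by (intro Bochner_Integration.integral_nonneg m.integral_tensor_square_nonneg[of "\<lambda>u. D u _"])
  also have "\<dots> = (\<integral>q. (\<integral>\<omega>. D (fst q) \<omega> * D (snd q) \<omega> \<partial>M) \<partial>(\<mu> \<Otimes>\<^sub>M \<mu>))"
    using G_int by (rule PM.Fubini_integral)
  also have "\<dots> = 2 * (\<integral>q. k 0 q \<partial>(\<mu> \<Otimes>\<^sub>M \<mu>)) - (\<integral>q. k \<tau> q \<partial>(\<mu> \<Otimes>\<^sub>M \<mu>)) - (\<integral>q. k (- \<tau>) q \<partial>(\<mu> \<Otimes>\<^sub>M \<mu>))"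
    unfolding D_cov by (simp add: k_int)
  \<comment> \<open>Exchanging the two coordinates reverses the sign of their difference, and
    evenness of \<open>R\<close> then turns the shift \<open>- \<tau>\<close> into
    \<open>\<tau>\<close>. What remains is twice the difference of the two integrals to be
    compared.\<close>
  also have "(\<integral>q. k (- \<tau>) q \<partial>(\<mu> \<Otimes>\<^sub>M \<mu>)) = (\<integral>q. k \<tau> q \<partial>(\<mu> \<Otimes>\<^sub>M \<mu>))"
  proof -
    have "k (- \<tau>) (u, v) = k \<tau> (v, u)" for u v
      using cov_even[of "a * (v - u) + \<tau>"] by (simp add: k_def algebra_simps)
    then have "(\<integral>q. k (- \<tau>) q \<partial>(\<mu> \<Otimes>\<^sub>M \<mu>)) = (\<integral>(u, v). k \<tau> (v, u) \<partial>(\<mu> \<Otimes>\<^sub>M \<mu>))"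
      by (intro Bochner_Integration.integral_cong) auto
    also have "\<dots> = (\<integral>q. k \<tau> q \<partial>(\<mu> \<Otimes>\<^sub>M \<mu>))"
      by (rule mm.integral_product_swap) measurable
    finally show ?thesis .
  qed
  finally have "(\<integral>q. k \<tau> q \<partial>(\<mu> \<Otimes>\<^sub>M \<mu>)) \<le> (\<integral>q. k 0 q \<partial>(\<mu> \<Otimes>\<^sub>M \<mu>))" by simp
  moreover have nn: "(\<integral>\<^sup>+q. ennreal (k \<sigma> q) \<partial>(\<mu> \<Otimes>\<^sub>M \<mu>)) = ennreal (\<integral>q. k \<sigma> q \<partial>(\<mu> \<Otimes>\<^sub>M \<mu>))" for \<sigma>
    by (intro nn_integral_eq_integral k_int) (auto simp: k_def cov_pos less_imp_le)
  ultimately show ?thesis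
    using nn[of 0] nn[of \<tau>] by (simp add: k_def ennreal_leI)
qed

text \<open>The scale \<open>a * (1 + h)\<close> cancels the division in \<open>smear\<close>. Each
  pair of uniform values then contributes the energy of \<open>\<mu>\<close> with the kernel shifted
  by \<open>a * h\<close> times their difference, at most the unshifted energy by
  \<open>cov_shift_le\<close>.\<close>

lemma kernel_energy_cov_smear_le:
  assumes \<mu>: "\<mu> \<in> prob_measures_01" and h: "h > 0"
  shows "kernel_energy (\<lambda>x. ennreal (R (a * (1 + h) * x))) (smear h \<mu>) \<le> kernel_energy (\<lambda>x. ennreal (R (a * x))) \<mu>"
proof -
  interpret U: prob_space unif01 by (rule prob_space_unif01)
  interpret UU: pair_prob_space unif01 unif01 ..
  have eq: "a * (1 + h) * ((x + h * d) / (1 + h)) = a * x + a * h * d" for x d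
    using h by (simp add: field_simps)
  have "kernel_energy (\<lambda>x. ennreal (R (a * (1 + h) * x))) (smear h \<mu>) =
      (\<integral>\<^sup>+p. (\<integral>\<^sup>+q. ennreal (R (a * (fst q - snd q) + a * h * (fst p - snd p))) \<partial>(\<mu> \<Otimes>\<^sub>M \<mu>)) \<partial>(unif01 \<Otimes>\<^sub>M unif01))"
    by (subst kernel_energy_smear(1)[OF \<mu>]) (auto simp only: eq, measurable)
  also have "\<dots> \<le> (\<integral>\<^sup>+p. kernel_energy (\<lambda>x. ennreal (R (a * x))) \<mu> \<partial>(unif01 \<Otimes>\<^sub>M unif01))"
    by (intro nn_integral_mono) (simp add: kernel_energy_pair[OF \<mu>] cov_shift_le[OF \<mu>])
  also have "\<dots> = kernel_energy (\<lambda>x. ennreal (R (a * x))) \<mu>"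
    by (simp add: UU.emeasure_space_1)
  finally show ?thesis .
qed

end

section \<open>The Riesz kernel\<close>

text \<open>The value at 0 is set separately because \<open>0 powr (-\<beta>)\<close> is 0 by
  default; it makes atoms cost infinite energy.\<close>

definition riesz_kernel :: "real \<Rightarrow> real \<Rightarrow> ennreal" where
  "riesz_kernel \<beta> x = (if x = 0 then \<infinity> else ennreal (\<bar>x\<bar> powr (-\<beta>)))"

lemma riesz_kernel_measurable [measurable]: "riesz_kernel \<beta> \<in> borel_measurable borel"
  unfolding riesz_kernel_def by measurable

lemma riesz_energy_eq: "riesz_energy \<beta> \<mu> = kernel_energy (riesz_kernel \<beta>) \<mu>"
  by (simp add: riesz_energy_def kernel_energy_def riesz_kernel_def)

lemma riesz_kernel_scale:
  assumes "c > 0"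
  shows "riesz_kernel \<beta> (c * x) = ennreal (c powr (-\<beta>)) * riesz_kernel \<beta> x"
  using assms by (auto simp: riesz_kernel_def abs_mult powr_mult ennreal_mult ennreal_mult_eq_top_iff)

lemma riesz_kernel_antimono:
  assumes "0 < \<beta>" "\<bar>x\<bar> \<le> \<bar>y\<bar>"
  shows "riesz_kernel \<beta> y \<le> riesz_kernel \<beta> x"
  using assms by (auto simp: riesz_kernel_def intro!: ennreal_leI powr_mono2')

section \<open>Integrability and smoothing of the Riesz kernel\<close>

lemma riesz_kernel_integral_finite:
  assumes "\<beta> < 1"
  shows "(\<integral>\<^sup>+x. indicator {-1..1} x * riesz_kernel \<beta> x \<partial>lborel) < \<infinity>"
proof -
  have "(\<integral>\<^sup>+x. indicator {-1..1} x * riesz_kernel \<beta> x \<partial>lborel) =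
      (\<integral>\<^sup>+x. ennreal (indicator {-1..1} x * \<bar>x\<bar> powr (-\<beta>)) \<partial>lborel)"
    using AE_lborel_singleton[of 0]
    by (intro nn_integral_cong_AE, eventually_elim) (auto simp: riesz_kernel_def indicator_def)
  also have "\<dots> = ennreal (\<integral>x. indicator {-1..1} x * \<bar>x\<bar> powr (-\<beta>) \<partial>lborel)"
    by (intro nn_integral_eq_integral integrable_abs_powr assms) auto
  finally show ?thesis by simp
qed

text \<open>The kernel whose energy at \<open>\<mu>\<close> is the Riesz energy of
  \<open>smear h \<mu>\<close>, by the second form of \<open>kernel_energy_smear\<close>.\<close>

definition smeared_riesz :: "real \<Rightarrow> real \<Rightarrow> real \<Rightarrow> ennreal" where
  "smeared_riesz \<beta> h x = (\<integral>\<^sup>+p. riesz_kernel \<beta> ((x + h * (fst p - snd p)) / (1 + h)) \<partial>(unif01 \<Otimes>\<^sub>M unif01))"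

lemma AE_unif01_pair: "AE p in unif01 \<Otimes>\<^sub>M unif01. \<bar>fst p - snd p\<bar> \<le> 1"
proof -
  interpret U: prob_space unif01 by (rule prob_space_unif01)
  interpret UU: pair_prob_space unif01 unif01 ..
  show ?thesis
  proof (rule UU.AE_pair_measure)
    show "AE s in unif01. AE t in unif01. \<bar>fst (s, t) - snd (s, t)\<bar> \<le> 1"
      using AE_unif01
    proof eventually_elim
      fix s :: real assume "s \<in> {0..1}"
      show "AE t in unif01. \<bar>fst (s, t) - snd (s, t)\<bar> \<le> 1"
        using AE_unif01 by eventually_elim (use \<open>s \<in> {0..1}\<close> in auto)
    qed
  qed measurable
qed

lemma smeared_riesz_le:
  assumes "\<And>d. \<bar>d\<bar> \<le> 1 \<Longrightarrow> riesz_kernel \<beta> ((x + h * d) / (1 + h)) \<le> C"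
  shows "smeared_riesz \<beta> h x \<le> C"
proof -
  interpret U: prob_space unif01 by (rule prob_space_unif01)
  interpret UU: pair_prob_space unif01 unif01 ..
  have "smeared_riesz \<beta> h x \<le> (\<integral>\<^sup>+p. C \<partial>(unif01 \<Otimes>\<^sub>M unif01))"
    unfolding smeared_riesz_def
    using AE_unif01_pair by (intro nn_integral_mono_AE, eventually_elim) (rule assms)
  then show ?thesis by (simp add: UU.emeasure_space_1)
qed

lemma smeared_riesz_ge:
  assumes "\<And>d. \<bar>d\<bar> \<le> 1 \<Longrightarrow> C \<le> riesz_kernel \<beta> ((x + h * d) / (1 + h))"
  shows "C \<le> smeared_riesz \<beta> h x"
proof -
  interpret U: prob_space unif01 by (rule prob_space_unif01)
  interpret UU: pair_prob_space unif01 unif01 ..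
  have "(\<integral>\<^sup>+p. C \<partial>(unif01 \<Otimes>\<^sub>M unif01)) \<le> smeared_riesz \<beta> h x"
    unfolding smeared_riesz_def
    using AE_unif01_pair by (intro nn_integral_mono_AE, eventually_elim) (rule assms)
  then show ?thesis by (simp add: UU.emeasure_space_1)
qed

text \<open>A bound on the potential of the uniform law that does not depend on \<open>z\<close>:
  the kernel is at most 1 outside \<open>{-1..1}\<close> and locally integrable inside.\<close>

lemma riesz_kernel_unif01_le:
  assumes "0 < \<beta>"
  shows "(\<integral>\<^sup>+t. riesz_kernel \<beta> (z - t) \<partial>unif01) \<le> 1 + (\<integral>\<^sup>+x. indicator {-1..1} x * riesz_kernel \<beta> x \<partial>lborel)"
    (is "_ \<le> 1 + ?I")
proof -
  have le: "riesz_kernel \<beta> x \<le> 1 + indicator {-1..1} x * riesz_kernel \<beta> x" for x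
    using riesz_kernel_antimono[OF assms, of 1 x]
    by (cases "x \<in> {-1..1}") (auto simp: riesz_kernel_def[of _ 1] abs_le_iff not_le intro: order_trans)
  have "(\<integral>\<^sup>+t. riesz_kernel \<beta> (z - t) \<partial>unif01) = (\<integral>\<^sup>+t. riesz_kernel \<beta> (z - t) * indicator {0..1} t \<partial>lborel)"
    by (subst nn_integral_uniform_measure) (auto simp: divide_ennreal_def)
  also have "\<dots> \<le> (\<integral>\<^sup>+t. indicator {0..1} t + indicator {-1..1} (z + (-1) * t) * riesz_kernel \<beta> (z + (-1) * t) \<partial>lborel)"
  proof (intro nn_integral_mono)
    fix t
    show "riesz_kernel \<beta> (z - t) * indicator {0..1} t \<le>
        indicator {0..1} t + indicator {-1..1} (z + (-1) * t) * riesz_kernel \<beta> (z + (-1) * t)"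
      using le[of "z - t"] by (cases "t \<in> {0..1}") auto
  qed
  also have "\<dots> = 1 + (\<integral>\<^sup>+t. indicator {-1..1} (z + (-1) * t) * riesz_kernel \<beta> (z + (-1) * t) \<partial>lborel)"
    by (subst nn_integral_add) auto
  also have "(\<integral>\<^sup>+t. indicator {-1..1} (z + (-1) * t) * riesz_kernel \<beta> (z + (-1) * t) \<partial>lborel) = ?I"
    by (subst nn_integral_real_affine[of "\<lambda>x. indicator {-1..1} x * riesz_kernel \<beta> x" "-1" z]) auto
  finally show ?thesis .
qed

text \<open>One constant for all \<open>h\<close>, as dominated convergence requires. For
  \<open>\<bar>x\<bar> \<ge> 2 * h\<close>, smearing moves \<open>x\<close> by at most half its size
  and divides by at most 2, so the argument keeps at least a quarter of its size. For smaller
  \<open>x\<close>, scaling out \<open>h / 2\<close> leaves a uniform potential bounded by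
  \<open>C0\<close>, and the factor \<open>(h / 2) powr (-\<beta>)\<close> is at most the kernel at
  \<open>x / 4\<close>.\<close>

lemma smeared_riesz_dominated:
  assumes beta: "0 < \<beta>" "\<beta> < 1"
  shows "\<exists>C<\<infinity>. \<forall>h\<in>{0<..1}. \<forall>x. smeared_riesz \<beta> h x \<le> C * riesz_kernel \<beta> x"
proof -
  define C0 where "C0 = 1 + (\<integral>\<^sup>+x. indicator {-1..1} x * riesz_kernel \<beta> x \<partial>lborel)"
  have C0: "C0 < \<infinity>" "C0 \<ge> 1"
    using riesz_kernel_integral_finite[OF beta(2)] by (auto simp: C0_def)
  interpret U: prob_space unif01 by (rule prob_space_unif01)
  have "smeared_riesz \<beta> h x \<le> C0 * riesz_kernel \<beta> (1 / 4 * x)" if h: "h \<in> {0<..1}" for h x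
  proof (cases "\<bar>x\<bar> \<ge> 2 * h")
    case True
    have "smeared_riesz \<beta> h x \<le> riesz_kernel \<beta> (1 / 4 * x)"
    proof (intro smeared_riesz_le riesz_kernel_antimono beta)
      fix d :: real assume d: "\<bar>d\<bar> \<le> 1"
      have "\<bar>h * d\<bar> \<le> h" using d h by (simp add: abs_mult mult_left_le)
      then have "\<bar>x\<bar> / 2 \<le> \<bar>x + h * d\<bar>" using True by linarith
      then have "\<bar>x\<bar> / 2 / 2 \<le> \<bar>x + h * d\<bar> / (1 + h)" using h by (intro frac_le) auto
      then show "\<bar>1 / 4 * x\<bar> \<le> \<bar>(x + h * d) / (1 + h)\<bar>" using h by (simp add: abs_mult)
    qed
    also have "\<dots> \<le> C0 * riesz_kernel \<beta> (1 / 4 * x)"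
      using mult_right_mono[OF C0(2), of "riesz_kernel \<beta> (1 / 4 * x)"] by simp
    finally show ?thesis .
  next
    case False
    have "smeared_riesz \<beta> h x \<le> (\<integral>\<^sup>+p. riesz_kernel \<beta> (h / 2 * ((x + h * fst p) / h - snd p)) \<partial>(unif01 \<Otimes>\<^sub>M unif01))"
      unfolding smeared_riesz_def
    proof (intro nn_integral_mono riesz_kernel_antimono beta)
      fix p :: "real \<times> real"
      have e: "h / 2 * ((x + h * fst p) / h - snd p) = (x + h * (fst p - snd p)) / 2"
        using h by (simp add: field_simps)
      show "\<bar>h / 2 * ((x + h * fst p) / h - snd p)\<bar> \<le> \<bar>(x + h * (fst p - snd p)) / (1 + h)\<bar>"
        unfolding e abs_divide using h by (intro divide_left_mono) auto
    qed
    also have "\<dots> = (\<integral>\<^sup>+s. (\<integral>\<^sup>+t. riesz_kernel \<beta> (h / 2 * ((x + h * s) / h - t)) \<partial>unif01) \<partial>unif01)"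
      by (subst U.nn_integral_fst[symmetric]) auto
    also have "\<dots> = (\<integral>\<^sup>+s. ennreal ((h / 2) powr (-\<beta>)) * (\<integral>\<^sup>+t. riesz_kernel \<beta> ((x + h * s) / h - t) \<partial>unif01) \<partial>unif01)"
      using h by (subst riesz_kernel_scale) (auto intro!: nn_integral_cong nn_integral_cmult)
    also have "\<dots> \<le> (\<integral>\<^sup>+s. ennreal ((h / 2) powr (-\<beta>)) * C0 \<partial>unif01)"
      unfolding C0_def by (intro nn_integral_mono mult_left_mono riesz_kernel_unif01_le beta) auto
    also have "\<dots> = C0 * riesz_kernel \<beta> (h / 2)"
      using h by (simp add: U.emeasure_space_1 riesz_kernel_def mult.commute)
    also have "\<dots> \<le> C0 * riesz_kernel \<beta> (1 / 4 * x)"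
      using False h by (intro mult_left_mono riesz_kernel_antimono beta) (auto simp: abs_mult)
    finally show ?thesis .
  qed
  then have "\<forall>h\<in>{0<..1}. \<forall>x. smeared_riesz \<beta> h x \<le> C0 * ennreal ((1 / 4) powr (-\<beta>)) * riesz_kernel \<beta> x"
    by (subst (asm) riesz_kernel_scale) (auto simp: mult.assoc)
  moreover have "C0 * ennreal ((1 / 4) powr (-\<beta>)) < \<infinity>"
    using C0(1) by (simp add: ennreal_mult_less_top)
  ultimately show ?thesis by blast
qed

text \<open>With \<open>h = inverse (real (Suc n))\<close>, the smeared argument has absolute value
  between \<open>(\<bar>x\<bar> - h) / (1 + h)\<close> and \<open>\<bar>x\<bar> + h\<close>;
  monotonicity of the kernel gives the sandwich.\<close>

lemma smeared_riesz_tendsto: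
  assumes beta: "0 < \<beta>" and x: "x \<noteq> 0"
  shows "(\<lambda>n. smeared_riesz \<beta> (inverse (real (Suc n))) x) \<longlonglongrightarrow> riesz_kernel \<beta> x"
proof (rule tendsto_sandwich)
  note lim = LIMSEQ_inverse_real_of_nat
  have h1: "h > 0" "\<bar>h * d\<bar> \<le> h" if "h = inverse (real (Suc n))" "\<bar>d\<bar> \<le> 1" for h d n
    using that by (auto simp: abs_mult mult_left_le)
  have ev: "\<forall>\<^sub>F n in sequentially. inverse (real (Suc n)) < \<bar>x\<bar>"
    using order_tendstoD(2)[OF lim, of "\<bar>x\<bar>"] x by simp
  have "(\<lambda>n. ennreal ((\<bar>x\<bar> + inverse (real (Suc n))) powr (-\<beta>))) \<longlonglongrightarrow> ennreal ((\<bar>x\<bar> + 0) powr (-\<beta>))"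
    using x by (intro tendsto_ennrealI tendsto_powr tendsto_add tendsto_const lim) auto
  then show "(\<lambda>n. ennreal ((\<bar>x\<bar> + inverse (real (Suc n))) powr (-\<beta>))) \<longlonglongrightarrow> riesz_kernel \<beta> x"
    using x by (simp add: riesz_kernel_def)
  show "\<forall>\<^sub>F n in sequentially. ennreal ((\<bar>x\<bar> + inverse (real (Suc n))) powr (-\<beta>)) \<le> smeared_riesz \<beta> (inverse (real (Suc n))) x"
  proof (rule always_eventually, rule allI)
    fix n
    define h where "h = inverse (real (Suc n))"
    have "ennreal ((\<bar>x\<bar> + h) powr (-\<beta>)) = riesz_kernel \<beta> (\<bar>x\<bar> + h)"
      using x h1(1)[OF h_def, of 0] by (auto simp: riesz_kernel_def)
    also have "\<dots> \<le> smeared_riesz \<beta> h x"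
    proof (intro smeared_riesz_ge riesz_kernel_antimono beta)
      fix d :: real assume d: "\<bar>d\<bar> \<le> 1"
      note hd = h1[OF h_def d]
      have "\<bar>(x + h * d) / (1 + h)\<bar> \<le> \<bar>x + h * d\<bar> / 1"
        unfolding abs_divide using hd by (intro divide_left_mono) auto
      also have "\<dots> \<le> \<bar>\<bar>x\<bar> + h\<bar>"
        using order_trans[OF abs_triangle_ineq add_left_mono[OF hd(2)], of x] hd(1) by simp
      finally show "\<bar>(x + h * d) / (1 + h)\<bar> \<le> \<bar>\<bar>x\<bar> + h\<bar>" .
    qed
    finally show "ennreal ((\<bar>x\<bar> + inverse (real (Suc n))) powr (-\<beta>)) \<le> smeared_riesz \<beta> (inverse (real (Suc n))) x"
      by (simp only: h_def)
  qed
  have "(\<lambda>n. ennreal (((\<bar>x\<bar> - inverse (real (Suc n))) / (1 + inverse (real (Suc n)))) powr (-\<beta>)))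
      \<longlonglongrightarrow> ennreal (((\<bar>x\<bar> - 0) / (1 + 0)) powr (-\<beta>))"
    using x by (intro tendsto_ennrealI tendsto_powr tendsto_add tendsto_diff tendsto_divide tendsto_const lim) auto
  then show "(\<lambda>n. ennreal (((\<bar>x\<bar> - inverse (real (Suc n))) / (1 + inverse (real (Suc n)))) powr (-\<beta>)))
      \<longlonglongrightarrow> riesz_kernel \<beta> x"
    using x by (simp add: riesz_kernel_def)
  show "\<forall>\<^sub>F n in sequentially. smeared_riesz \<beta> (inverse (real (Suc n))) x \<le>
      ennreal (((\<bar>x\<bar> - inverse (real (Suc n))) / (1 + inverse (real (Suc n)))) powr (-\<beta>))"
    using ev
  proof eventually_elim
    fix n
    define h where "h = inverse (real (Suc n))"
    assume "inverse (real (Suc n)) < \<bar>x\<bar>"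
    then have hx: "h < \<bar>x\<bar>" by (simp only: h_def)
    have h0: "h > 0" by (simp add: h_def)
    have "smeared_riesz \<beta> h x \<le> riesz_kernel \<beta> ((\<bar>x\<bar> - h) / (1 + h))"
    proof (intro smeared_riesz_le riesz_kernel_antimono beta)
      fix d :: real assume d: "\<bar>d\<bar> \<le> 1"
      note hd = h1[OF h_def d]
      have "\<bar>x\<bar> - h \<le> \<bar>x + h * d\<bar>" using hd(2) by linarith
      then have "\<bar>\<bar>x\<bar> - h\<bar> \<le> \<bar>x + h * d\<bar>" using hx by simp
      then show "\<bar>(\<bar>x\<bar> - h) / (1 + h)\<bar> \<le> \<bar>(x + h * d) / (1 + h)\<bar>"
        unfolding abs_divide by (rule divide_right_mono) simp
    qed
    also have "\<dots> = ennreal (((\<bar>x\<bar> - h) / (1 + h)) powr (-\<beta>))"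
      using hx h0 by (auto simp: riesz_kernel_def)
    finally show "smeared_riesz \<beta> (inverse (real (Suc n))) x \<le>
      ennreal (((\<bar>x\<bar> - inverse (real (Suc n))) / (1 + inverse (real (Suc n)))) powr (-\<beta>))"
      by (simp only: h_def)
  qed
qed

lemma riesz_energy_smear_tendsto:
  assumes \<mu>: "\<mu> \<in> prob_measures_01" and beta: "0 < \<beta>" "\<beta> < 1"
    and fin: "riesz_energy \<beta> \<mu> < \<infinity>"
  shows "(\<lambda>n. riesz_energy \<beta> (smear (inverse (real (Suc n))) \<mu>)) \<longlonglongrightarrow> riesz_energy \<beta> \<mu>"
proof -
  note [measurable_cong] = prob_measures_01D(2)[OF \<mu>]
  interpret U: prob_space unif01 by (rule prob_space_unif01)
  interpret UU: pair_prob_space unif01 unif01 ..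
  obtain C where C: "C < \<infinity>" "\<And>h x. h \<in> {0<..1} \<Longrightarrow> smeared_riesz \<beta> h x \<le> C * riesz_kernel \<beta> x"
    using smeared_riesz_dominated[OF beta] by blast
  have E: "riesz_energy \<beta> \<mu> = (\<integral>\<^sup>+q. riesz_kernel \<beta> (fst q - snd q) \<partial>(\<mu> \<Otimes>\<^sub>M \<mu>))"
    by (simp add: riesz_energy_eq kernel_energy_pair[OF \<mu>])
  have Es: "riesz_energy \<beta> (smear h \<mu>) = (\<integral>\<^sup>+q. smeared_riesz \<beta> h (fst q - snd q) \<partial>(\<mu> \<Otimes>\<^sub>M \<mu>))" for h
    unfolding riesz_energy_eq smeared_riesz_def by (rule kernel_energy_smear(2)[OF \<mu>]) measurable
  show ?thesis unfolding E Es
  proof (rule nn_integral_dominated_convergence[where w = "\<lambda>q. C * riesz_kernel \<beta> (fst q - snd q)"])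
    show "(\<lambda>q. smeared_riesz \<beta> (inverse (real (Suc i))) (fst q - snd q)) \<in> borel_measurable (\<mu> \<Otimes>\<^sub>M \<mu>)" for i
      unfolding smeared_riesz_def by measurable
    show "AE q in \<mu> \<Otimes>\<^sub>M \<mu>. smeared_riesz \<beta> (inverse (real (Suc j))) (fst q - snd q) \<le> C * riesz_kernel \<beta> (fst q - snd q)" for j
      by (intro AE_I2 C(2)) (auto simp: inverse_le_1_iff)
    show "(\<integral>\<^sup>+q. C * riesz_kernel \<beta> (fst q - snd q) \<partial>(\<mu> \<Otimes>\<^sub>M \<mu>)) < \<infinity>"
      using C(1) fin unfolding E by (subst nn_integral_cmult) (auto simp: ennreal_mult_less_top)
    \<comment> \<open>Finite energy makes the diagonal a null set, so the pointwise limit is needed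
      only at nonzero differences.\<close>
    have "AE q in \<mu> \<Otimes>\<^sub>M \<mu>. riesz_kernel \<beta> (fst q - snd q) \<noteq> \<infinity>"
      using fin unfolding E by (intro nn_integral_noteq_infinite) auto
    then show "AE q in \<mu> \<Otimes>\<^sub>M \<mu>. (\<lambda>i. smeared_riesz \<beta> (inverse (real (Suc i))) (fst q - snd q))
        \<longlonglongrightarrow> riesz_kernel \<beta> (fst q - snd q)"
      by eventually_elim (rule smeared_riesz_tendsto[OF beta(1)], auto simp: riesz_kernel_def split: if_splits)
  qed measurable
qed

text \<open>Differences within the unit interval have size at most 1, where the kernel is at least
  1. This keeps the limit away from 0 when reciprocals are taken.\<close>

lemma riesz_energy_ge_1:
  assumes \<mu>: "\<mu> \<in> prob_measures_01" and beta: "0 < \<beta>"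
  shows "1 \<le> riesz_energy \<beta> \<mu>"
proof -
  interpret m: prob_space \<mu> by (rule prob_measures_01D(1)[OF \<mu>])
  have "1 = (\<integral>\<^sup>+u. (\<integral>\<^sup>+v. 1 \<partial>\<mu>) \<partial>\<mu>)" by (simp add: m.emeasure_space_1)
  also have "\<dots> \<le> riesz_energy \<beta> \<mu>"
    unfolding riesz_energy_eq kernel_energy_def
  proof (intro nn_integral_mono_AE)
    show "AE u in \<mu>. (\<integral>\<^sup>+v. 1 \<partial>\<mu>) \<le> (\<integral>\<^sup>+v. riesz_kernel \<beta> (u - v) \<partial>\<mu>)"
      using prob_measures_01D(3)[OF \<mu>]
    proof eventually_elim
      fix u :: real assume u: "u \<in> {0..1}"
      show "(\<integral>\<^sup>+v. 1 \<partial>\<mu>) \<le> (\<integral>\<^sup>+v. riesz_kernel \<beta> (u - v) \<partial>\<mu>)"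
        using prob_measures_01D(3)[OF \<mu>]
      proof (intro nn_integral_mono_AE, eventually_elim)
        fix v :: real assume "v \<in> {0..1}"
        then show "1 \<le> riesz_kernel \<beta> (u - v)"
          using u riesz_kernel_antimono[OF beta, of "u - v" 1] by (auto simp: riesz_kernel_def[of _ 1])
      qed
    qed
  qed
  finally show ?thesis .
qed

lemma riesz_energy_smear_finite:
  assumes "\<mu> \<in> prob_measures_01" "h > 0" "\<beta> < 1"
  shows "riesz_energy \<beta> (smear h \<mu>) < \<infinity>"
proof -
  have "riesz_energy \<beta> (smear h \<mu>) \<le> ennreal ((1 + h) / h) * (\<integral>\<^sup>+x. indicator {-1..1} x * riesz_kernel \<beta> x \<partial>lborel)"
    unfolding riesz_energy_eq by (intro kernel_energy_smear_le assms) measurable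
  also have "\<dots> < \<infinity>" using riesz_kernel_integral_finite[OF assms(3)] by (simp add: ennreal_mult_less_top)
  finally show ?thesis .
qed

section \<open>Asymptotics of the minimal energy\<close>

context regularly_varying
begin

definition cov_energy :: "real \<Rightarrow> real measure \<Rightarrow> real" where
  "cov_energy a \<mu> = (\<integral>u. (\<integral>v. R (a * (u - v)) \<partial>\<mu>) \<partial>\<mu>)"

lemma ennreal_cov_energy:
  assumes \<mu>: "\<mu> \<in> prob_measures_01"
  shows "ennreal (cov_energy a \<mu>) = kernel_energy (\<lambda>x. ennreal (R (a * x))) \<mu>"
proof -
  note [measurable_cong] = prob_measures_01D(2)[OF \<mu>]
  interpret m: prob_space \<mu> by (rule prob_measures_01D(1)[OF \<mu>])
  interpret mm: pair_prob_space \<mu> \<mu> ..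
  have int: "integrable (\<mu> \<Otimes>\<^sub>M \<mu>) (\<lambda>q. R (a * (fst q - snd q)))"
    by (rule mm.integrable_const_bound[where B = "R 0"]) (use R_le R_pos in \<open>auto simp: abs_of_pos\<close>)
  have "cov_energy a \<mu> = (\<integral>q. R (a * (fst q - snd q)) \<partial>(\<mu> \<Otimes>\<^sub>M \<mu>))"
    using mm.integral_fst'[OF int] by (simp add: cov_energy_def)
  also have "ennreal \<dots> = kernel_energy (\<lambda>x. ennreal (R (a * x))) \<mu>"
    unfolding kernel_energy_pair[OF \<mu>, of "\<lambda>x. ennreal (R (a * x))", simplified]
    by (intro nn_integral_eq_integral[symmetric] int) (auto simp: R_pos less_imp_le)
  finally show ?thesis .
qed

lemma cov_energy_nonneg: "cov_energy a \<mu> \<ge> 0"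
  unfolding cov_energy_def by (intro Bochner_Integration.integral_nonneg) (auto simp: R_pos less_imp_le)

lemma ennreal_cov_energy_ratio:
  assumes \<mu>: "\<mu> \<in> prob_measures_01"
  shows "ennreal (cov_energy a \<mu> / R b) = kernel_energy (\<lambda>x. ennreal (R (a * x) / R b)) \<mu>"
proof -
  note [measurable_cong] = prob_measures_01D(2)[OF \<mu>]
  have "ennreal (cov_energy a \<mu> / R b) = ennreal (1 / R b) * kernel_energy (\<lambda>x. ennreal (R (a * x))) \<mu>"
    using R_pos[of b] cov_energy_nonneg
    by (simp add: ennreal_cov_energy[OF \<mu>, symmetric] ennreal_mult[symmetric])
  also have "\<dots> = (\<integral>\<^sup>+q. ennreal (1 / R b) * ennreal (R (a * (fst q - snd q))) \<partial>(\<mu> \<Otimes>\<^sub>M \<mu>))"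
    by (subst kernel_energy_pair[OF \<mu>]) (auto simp: nn_integral_cmult)
  also have "\<dots> = (\<integral>\<^sup>+q. ennreal (R (a * (fst q - snd q)) / R b) \<partial>(\<mu> \<Otimes>\<^sub>M \<mu>))"
    by (intro nn_integral_cong) (simp add: R_pos less_imp_le ennreal_mult[symmetric])
  also have "\<dots> = kernel_energy (\<lambda>x. ennreal (R (a * x) / R b)) \<mu>"
    by (subst kernel_energy_pair[OF \<mu>]) auto
  finally show ?thesis .
qed

text \<open>The two kernels differ pointwise by at most \<open>g\<close>, and the bounded density of
  the smeared measure controls the energy of \<open>g\<close> by the \<open>L\<^sup>1\<close>
  defect. The error term does not involve \<open>\<mu>\<close>, which makes the estimate
  uniform.\<close>

lemma smear_energy_approx:
  assumes \<mu>: "\<mu> \<in> prob_measures_01" and h: "h > 0"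
  shows "ennreal (cov_energy a (smear h \<mu>) / R a) \<le> riesz_energy \<beta> (smear h \<mu>) + ennreal ((1 + h) / h) * L1_defect a"
    and "riesz_energy \<beta> (smear h \<mu>) \<le> ennreal (cov_energy a (smear h \<mu>) / R a) + ennreal ((1 + h) / h) * L1_defect a"
proof -
  \<comment> \<open>The infinite value at 0 lets both pointwise inequalities hold there too, where
    the Riesz kernel is infinite; the Lebesgue integral does not see it.\<close>
  define g where "g x = (if x = 0 then \<infinity> else ennreal \<bar>R (a * x) / R a - \<bar>x\<bar> powr (-\<beta>)\<bar>)" for x
  have [measurable]: "g \<in> borel_measurable borel" unfolding g_def by measurable
  define \<nu> where "\<nu> = smear h \<mu>"
  have \<nu>: "\<nu> \<in> prob_measures_01" unfolding \<nu>_def by (rule smear_prob_measure[OF \<mu> h])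
  have "(\<integral>\<^sup>+x. indicator {-1..1} x * g x \<partial>lborel) = L1_defect a"
    unfolding L1_defect_def using AE_lborel_singleton[of 0]
    by (intro nn_integral_cong_AE, eventually_elim) (auto simp: g_def indicator_def)
  then have g_le: "kernel_energy g \<nu> \<le> ennreal ((1 + h) / h) * L1_defect a"
    unfolding \<nu>_def using kernel_energy_smear_le[OF \<mu> _ h, of g] by simp
  have q: "R (a * x) / R a \<ge> 0" for x using R_pos by (simp add: less_imp_le)
  have "ennreal (R (a * x) / R a) \<le> riesz_kernel \<beta> x + g x" for x
    using q[of x] by (auto simp: riesz_kernel_def g_def ennreal_plus[symmetric] simp del: ennreal_plus intro!: ennreal_leI)
  then have "ennreal (cov_energy a \<nu> / R a) \<le> kernel_energy (\<lambda>x. riesz_kernel \<beta> x + g x) \<nu>"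
    unfolding ennreal_cov_energy_ratio[OF \<nu>] by (rule kernel_energy_mono)
  also have "\<dots> = riesz_energy \<beta> \<nu> + kernel_energy g \<nu>"
    unfolding riesz_energy_eq by (rule kernel_energy_add[OF \<nu>]) measurable
  also have "\<dots> \<le> riesz_energy \<beta> \<nu> + ennreal ((1 + h) / h) * L1_defect a"
    by (intro add_left_mono g_le)
  finally show "ennreal (cov_energy a (smear h \<mu>) / R a) \<le> riesz_energy \<beta> (smear h \<mu>) + ennreal ((1 + h) / h) * L1_defect a"
    by (simp only: \<nu>_def)
  have "riesz_kernel \<beta> x \<le> ennreal (R (a * x) / R a) + g x" for x
    using q[of x] by (auto simp: riesz_kernel_def g_def ennreal_plus[symmetric] simp del: ennreal_plus intro!: ennreal_leI)
  then have "riesz_energy \<beta> \<nu> \<le> kernel_energy (\<lambda>x. ennreal (R (a * x) / R a) + g x) \<nu>"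
    unfolding riesz_energy_eq by (rule kernel_energy_mono)
  also have "\<dots> = ennreal (cov_energy a \<nu> / R a) + kernel_energy g \<nu>"
    unfolding ennreal_cov_energy_ratio[OF \<nu>] by (rule kernel_energy_add[OF \<nu>]) measurable
  also have "\<dots> \<le> ennreal (cov_energy a \<nu> / R a) + ennreal ((1 + h) / h) * L1_defect a"
    by (intro add_left_mono g_le)
  finally show "riesz_energy \<beta> (smear h \<mu>) \<le> ennreal (cov_energy a (smear h \<mu>) / R a) + ennreal ((1 + h) / h) * L1_defect a"
    by (simp only: \<nu>_def)
qed

lemma eventually_defect_less:
  assumes "\<delta> > 0"
  shows "\<forall>\<^sub>F a in at_top. ennreal ((1 + h) / h) * L1_defect a < ennreal \<delta>"
proof -
  have "((\<lambda>a. ennreal ((1 + h) / h) * L1_defect a) \<longlongrightarrow> ennreal ((1 + h) / h) * 0) at_top"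
    by (intro tendsto_mult_ennreal tendsto_const L1_defect_tendsto) auto
  then show ?thesis using assms by (intro order_tendstoD(2)) auto
qed

text \<open>The smearing inequality enters as a hypothesis because it rests on positive
  definiteness, which is proved in the locale of the process. In both bounds \<open>h\<close> is
  fixed first and \<open>a\<close> tends to infinity afterwards.\<close>

lemma min_cov_energy_asymptotics:
  assumes energy_smear_le: "\<And>\<mu> h a. \<mu> \<in> prob_measures_01 \<Longrightarrow> h > 0 \<Longrightarrow>
      cov_energy (a * (1 + h)) (smear h \<mu>) \<le> cov_energy a \<mu>"
    and min: "\<mu>\<beta> \<in> riesz_minimizers \<beta>"
  shows "riesz_energy \<beta> \<mu>\<beta> < \<infinity>"
    and "((\<lambda>a. Inf (cov_energy a ` prob_measures_01) / R a) \<longlongrightarrow> enn2real (riesz_energy \<beta> \<mu>\<beta>)) at_top"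
proof -
  have \<mu>\<beta>: "\<mu>\<beta> \<in> prob_measures_01"
    and E_le: "\<And>\<nu>. \<nu> \<in> prob_measures_01 \<Longrightarrow> riesz_energy \<beta> \<mu>\<beta> \<le> riesz_energy \<beta> \<nu>"
    using min by (auto simp: riesz_minimizers_def)
  \<comment> \<open>Any competitor with bounded density shows that the minimum is finite; a smeared
    copy of the minimizer is at hand.\<close>
  have "riesz_energy \<beta> \<mu>\<beta> \<le> riesz_energy \<beta> (smear 1 \<mu>\<beta>)"
    by (intro E_le smear_prob_measure \<mu>\<beta>) simp
  also have "\<dots> < \<infinity>" by (intro riesz_energy_smear_finite \<mu>\<beta> beta) simp
  finally show fin: "riesz_energy \<beta> \<mu>\<beta> < \<infinity>" .
  define e where "e = enn2real (riesz_energy \<beta> \<mu>\<beta>)"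
  have E: "riesz_energy \<beta> \<mu>\<beta> = ennreal e" using fin by (simp add: e_def ennreal_enn2real)
  have e_nonneg: "e \<ge> 0" by (simp add: e_def)
  define V where "V a = Inf (cov_energy a ` prob_measures_01)" for a
  have V_le: "V a \<le> cov_energy a \<mu>" if "\<mu> \<in> prob_measures_01" for a \<mu>
    unfolding V_def using that
    by (intro cInf_lower bdd_belowI[of _ 0]) (auto simp: cov_energy_nonneg)
  have V_ge: "c \<le> V a" if "\<And>\<mu>. \<mu> \<in> prob_measures_01 \<Longrightarrow> c \<le> cov_energy a \<mu>" for a c
    unfolding V_def using that \<mu>\<beta> by (intro cInf_greatest) auto
  have "((\<lambda>a. V a / R a) \<longlongrightarrow> e) at_top"
  proof (rule order_tendstoI)
    \<comment> \<open>Upper bound. Half of the gap \<open>y - e\<close> pays for smearing the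
      minimizer, the other half for the defect.\<close>
    fix y assume y: "e < y"
    define \<delta> where "\<delta> = (y - e) / 2"
    have \<delta>: "\<delta> > 0" "e + \<delta> + \<delta> = y" using y by (auto simp: \<delta>_def field_simps)
    have "\<forall>\<^sub>F n in sequentially. riesz_energy \<beta> (smear (inverse (real (Suc n))) \<mu>\<beta>) < ennreal (e + \<delta>)"
      using riesz_energy_smear_tendsto[OF \<mu>\<beta> beta fin] \<delta> e_nonneg
      by (intro order_tendstoD(2)) (auto simp: E ennreal_less_iff)
    then obtain n where "riesz_energy \<beta> (smear (inverse (real (Suc n))) \<mu>\<beta>) < ennreal (e + \<delta>)"
      by (auto dest: eventually_happens)
    then obtain h where h: "h > 0" "riesz_energy \<beta> (smear h \<mu>\<beta>) < ennreal (e + \<delta>)"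
      by (metis inverse_positive_iff_positive of_nat_0_less_iff zero_less_Suc)
    show "\<forall>\<^sub>F a in at_top. V a / R a < y"
      using eventually_defect_less[OF \<delta>(1), of h]
    proof eventually_elim
      fix a assume a: "ennreal ((1 + h) / h) * L1_defect a < ennreal \<delta>"
      have "ennreal (cov_energy a (smear h \<mu>\<beta>) / R a) \<le>
          riesz_energy \<beta> (smear h \<mu>\<beta>) + ennreal ((1 + h) / h) * L1_defect a"
        by (rule smear_energy_approx(1)[OF \<mu>\<beta> h(1)])
      also have "\<dots> < ennreal (e + \<delta>) + ennreal \<delta>"
        by (rule add_strict_mono[OF h(2) a])
      also have "\<dots> = ennreal y" using \<delta> e_nonneg by (simp add: ennreal_plus[symmetric] del: ennreal_plus)
      finally have "cov_energy a (smear h \<mu>\<beta>) / R a < y"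
        using cov_energy_nonneg R_pos[of a] by (simp add: ennreal_less_iff)
      moreover have "V a / R a \<le> cov_energy a (smear h \<mu>\<beta>) / R a"
        using R_pos[of a] by (intro divide_right_mono V_le smear_prob_measure \<mu>\<beta> h) auto
      ultimately show "V a / R a < y" by simp
    qed
  next
    fix y assume y: "y < e"
    define \<delta> where "\<delta> = (e - y) / 2"
    have \<delta>: "\<delta> > 0" "e - \<delta> > y" using y by (auto simp: \<delta>_def field_simps)
    \<comment> \<open>Lower bound. Passing from scale \<open>a\<close> to \<open>a * (1 + h)\<close>
      changes \<open>R\<close> by a factor tending to \<open>(1 + h) powr (-\<beta>)\<close>;
      \<open>h\<close> is taken so small that \<open>e - \<delta>\<close> times this factor still
      exceeds \<open>y\<close>.\<close>
    have "((\<lambda>h. (1 + h) powr (-\<beta>) * (e - \<delta>)) \<longlongrightarrow> (1 + 0) powr (-\<beta>) * (e - \<delta>)) (at_right 0)"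
      by (intro tendsto_intros) auto
    then have "\<forall>\<^sub>F h in at_right 0. y < (1 + h) powr (-\<beta>) * (e - \<delta>)"
      using \<delta>(2) by (intro order_tendstoD(1)) auto
    moreover have "\<forall>\<^sub>F h in at_right 0. (h :: real) > 0" by (simp add: eventually_at_right_less)
    ultimately have "\<forall>\<^sub>F h in at_right 0. h > 0 \<and> y < (1 + h) powr (-\<beta>) * (e - \<delta>)"
      by eventually_elim simp
    then obtain h where h: "h > 0" "y < (1 + h) powr (-\<beta>) * (e - \<delta>)"
      using eventually_happens[of _ "at_right (0::real)"] by auto
    have "((\<lambda>a. R ((1 + h) * a) / R a * (e - \<delta>)) \<longlongrightarrow> (1 + h) powr (-\<beta>) * (e - \<delta>)) at_top"
      using h by (intro tendsto_intros ratio_tendsto) simp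
    then have ev1: "\<forall>\<^sub>F a in at_top. y < R ((1 + h) * a) / R a * (e - \<delta>)"
      using h(2) by (rule order_tendstoD(1))
    have "filterlim (\<lambda>a. a * (1 + h)) at_top at_top"
      using h by (intro filterlim_at_top_mult_tendsto_pos[OF tendsto_const]) (auto simp: filterlim_ident)
    then have ev2: "\<forall>\<^sub>F a in at_top. ennreal ((1 + h) / h) * L1_defect (a * (1 + h)) < ennreal \<delta>"
      using eventually_defect_less[OF \<delta>(1), of h] by (rule eventually_compose_filterlim[rotated])
    show "\<forall>\<^sub>F a in at_top. y < V a / R a"
      using ev1 ev2
    proof eventually_elim
      fix a
      define b where "b = a * (1 + h)"
      assume 1: "y < R ((1 + h) * a) / R a * (e - \<delta>)"
        and "ennreal ((1 + h) / h) * L1_defect (a * (1 + h)) < ennreal \<delta>"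
      then have 2: "ennreal ((1 + h) / h) * L1_defect b < ennreal \<delta>" by (simp only: b_def)
      \<comment> \<open>The condition on \<open>a\<close> does not depend on the measure, so the
        estimate for each \<open>\<mu>\<close> passes to the infimum.\<close>
      have "R b * (e - \<delta>) \<le> V a"
      proof (rule V_ge)
        fix \<mu> assume \<mu>: "\<mu> \<in> prob_measures_01"
        have "ennreal e \<le> riesz_energy \<beta> (smear h \<mu>)"
          unfolding E[symmetric] by (intro E_le smear_prob_measure \<mu> h)
        also have "\<dots> \<le> ennreal (cov_energy b (smear h \<mu>) / R b) + ennreal ((1 + h) / h) * L1_defect b"
          by (rule smear_energy_approx(2)[OF \<mu> h(1)])
        also have "\<dots> \<le> ennreal (cov_energy b (smear h \<mu>) / R b) + ennreal \<delta>"
          using 2 by (intro add_left_mono) simp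
        also have "\<dots> = ennreal (cov_energy b (smear h \<mu>) / R b + \<delta>)"
          using \<delta> cov_energy_nonneg R_pos[of b] by (intro ennreal_plus[symmetric]) auto
        finally have "e \<le> cov_energy b (smear h \<mu>) / R b + \<delta>"
          using \<delta> cov_energy_nonneg R_pos[of b] by (subst (asm) ennreal_le_iff) auto
        then have "R b * (e - \<delta>) \<le> cov_energy b (smear h \<mu>)"
          using R_pos[of b] by (simp add: field_simps)
        also have "\<dots> \<le> cov_energy a \<mu>" unfolding b_def by (rule energy_smear_le[OF \<mu> h(1)])
        finally show "R b * (e - \<delta>) \<le> cov_energy a \<mu>" .
      qed
      then have "R b * (e - \<delta>) / R a \<le> V a / R a"
        using R_pos[of a] by (intro divide_right_mono) auto
      then show "y < V a / R a" using 1 by (simp add: b_def mult.commute)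
    qed
  qed
  then show "((\<lambda>a. Inf (cov_energy a ` prob_measures_01) / R a) \<longlongrightarrow> enn2real (riesz_energy \<beta> \<mu>\<beta>)) at_top"
    by (simp add: V_def e_def)
qed

end

section \<open>From the Gaussian process to the limit of \<open>R a * CX R a\<close>\<close>

theorem theorem7p2:
  fixes M :: "'a measure" and X :: "real \<Rightarrow> 'a \<Rightarrow> real" and R :: "real \<Rightarrow> real"
    and \<beta> :: real and \<mu>\<beta> :: "real measure"
  assumes gp: "gaussian_process M X"
    and centered: "\<forall>t. (\<integral>\<omega>. X t \<omega> \<partial>M) = 0"
    and stationary_cov: "\<forall>s t. R t = (\<integral>\<omega>. X (s + t) \<omega> * X s \<omega> \<partial>M)"
    and cont_paths: "AE \<omega> in M. continuous_on UNIV (\<lambda>t. X t \<omega>)"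
    and R_pos: "\<forall>t. R t > 0"
    and beta: "0 < \<beta>" "\<beta> < 1"
    and regvar: "\<exists>L. slowly_varying L \<and> (\<forall>t. t \<noteq> 0 \<longrightarrow> R t = L t / \<bar>t\<bar> powr \<beta>)"
    and minimizer: "\<mu>\<beta> \<in> riesz_minimizers \<beta>"
  shows "((\<lambda>a. R a * CX R a) \<longlongrightarrow> 1 / enn2real (riesz_energy \<beta> \<mu>\<beta>)) at_top"
proof -
  \<comment> \<open>Measurability at a single time comes from the one-term linear combination in
    \<open>gaussian_process\<close>.\<close>
  have X_meas [measurable]: "X t \<in> borel_measurable M" for t
  proof -
    have "real_gaussian_rv M (\<lambda>\<omega>. \<Sum>s\<in>{t}. 1 * X s \<omega>)"
      using gp[unfolded gaussian_process_def, THEN conjunct2, rule_format, of "{t}" "\<lambda>_. 1"] by simp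
    then show ?thesis by (simp add: real_gaussian_rv_def)
  qed
  obtain Y where Y: "case_prod Y \<in> borel_measurable (borel \<Otimes>\<^sub>M M)" "\<And>t. AE \<omega> in M. Y t \<omega> = X t \<omega>"
    using jointly_measurable_modification[OF X_meas cont_paths] by blast
  have Y_meas [measurable]: "Y t \<in> borel_measurable M" for t
    using measurable_compose[OF measurable_Pair1' Y(1), of t] by simp
  have prob: "prob_space M" using gp by (simp add: gaussian_process_def)
  \<comment> \<open>The modification agrees with \<open>X\<close> almost surely at each time and so
    has the same covariance.\<close>
  interpret S: measurable_stationary M Y R
  proof (intro measurable_stationary.intro prob measurable_stationary_axioms.intro)
    fix s t
    have "(\<integral>\<omega>. Y (s + t) \<omega> * Y s \<omega> \<partial>M) = (\<integral>\<omega>. X (s + t) \<omega> * X s \<omega> \<partial>M)"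
      using Y(2)[of "s + t"] Y(2)[of s] by (intro integral_cong_AE) (measurable, auto)
    then show "R t = (\<integral>\<omega>. Y (s + t) \<omega> * Y s \<omega> \<partial>M)" using stationary_cov by metis
  qed (use Y(1) R_pos in auto)
  obtain L where L: "slowly_varying L" "\<And>t. t \<noteq> 0 \<Longrightarrow> R t = L t / \<bar>t\<bar> powr \<beta>"
    using regvar by blast
  interpret RV: regularly_varying R \<beta>
  proof
    fix c :: real assume c: "c > 0"
    \<comment> \<open>For \<open>x > 0\<close> the powers of \<open>x\<close> in
      \<open>R (c * x) / R x\<close> cancel, leaving the ratio of \<open>L\<close> times
      \<open>c powr (-\<beta>)\<close>.\<close>
    have "((\<lambda>x. L (c * x) / L x * c powr (-\<beta>)) \<longlongrightarrow> 1 * c powr (-\<beta>)) at_top"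
      using L(1) c by (intro tendsto_mult tendsto_const) (auto simp: slowly_varying_def)
    moreover have "\<forall>\<^sub>F x in at_top. L (c * x) / L x * c powr (-\<beta>) = R (c * x) / R x"
      using eventually_gt_at_top[of 0]
      by eventually_elim (use c in \<open>auto simp: L(2) abs_mult powr_mult powr_minus field_simps\<close>)
    ultimately show "((\<lambda>x. R (c * x) / R x) \<longlongrightarrow> c powr (-\<beta>)) at_top"
      by (simp add: filterlim_cong)
  qed (use R_pos beta S.cov_le S.cov_even in auto)
  have le: "RV.cov_energy (a * (1 + h)) (smear h \<mu>) \<le> RV.cov_energy a \<mu>"
    if "\<mu> \<in> prob_measures_01" "h > 0" for \<mu> h a
    using S.kernel_energy_cov_smear_le[OF that, of a]
    by (simp add: RV.ennreal_cov_energy[symmetric] that smear_prob_measure ennreal_le_iff RV.cov_energy_nonneg)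
  have \<mu>\<beta>: "\<mu>\<beta> \<in> prob_measures_01" using minimizer by (simp add: riesz_minimizers_def)
  \<comment> \<open>Finiteness of the energy matters here: \<open>enn2real\<close> would send an
    infinite value to 0.\<close>
  have "1 \<le> enn2real (riesz_energy \<beta> \<mu>\<beta>)"
    using riesz_energy_ge_1[OF \<mu>\<beta> beta(1)] RV.min_cov_energy_asymptotics(1)[OF le minimizer]
    by (metis enn2real_1 enn2real_mono infinity_ennreal_def)
  then have "((\<lambda>a. 1 / (Inf (RV.cov_energy a ` prob_measures_01) / R a)) \<longlongrightarrow> 1 / enn2real (riesz_energy \<beta> \<mu>\<beta>)) at_top"
    by (intro tendsto_divide tendsto_const RV.min_cov_energy_asymptotics(2)[OF le minimizer]) auto
  then show ?thesis by (simp add: CX_def RV.cov_energy_def[abs_def])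
qed

end
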